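(* Let $A_1,\dots,A_k$ be stable matching instances on the same workers $\mathcal{W}$ and firms $\mathcal{F}$ ($|\mathcal{W}|=|\mathcal{F}|=n$) such that $n-1$ of the workers have the same preference list in all of them (firms and the remaining worker arbitrary). Then $\mathcal{L}'=\mathcal{M}_{A_1}\cap\cdots\cap\mathcal{M}_{A_k}$ is a sublattice of each $\mathcal{L}_{A_i}$. Moreover, for any feasible solution $x$ of the linear system $\sum_f x_{wf}=1$ for all $w$; $\sum_w x_{wf}=1$ for all $f$; $\sum_{f'<^{A_i}_w f} x_{wf'}-\sum_{w'>^{A_i}_f w} x_{w'f}\le 0$ for all $w,f$ and $i=1,\dots,k$; $x\ge 0$, and any $\theta\in[0,1]$ at no subinterval endpoint, the rounded matchings $\mu^{A_1}_\theta,\dots,\mu^{A_k}_\theta$ coincide and belong to $\mathcal{L}'$; and the worker-optimal and firm-optimal matchings of $\mathcal{L}'$ can be found in polynomial time.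
   Context: In a stable matching instance each agent strictly totally orders the agents of the other side; a perfect matching $M$ is stable under $I$ if no pair $(w,f)\notin M$ has $w$ preferring $f$ to $M(w)$ and $f$ preferring $w$ to $M(f)$ under $I$; $\mathcal{M}_I$ is the set of stable matchings and $\mathcal{L}_I$ its lattice, with join (meet) giving each worker its less (more) preferred partner under $I$; a sublattice is a subset closed under join and meet. Worker-optimal (firm-optimal) element of $\mathcal{L}'$: the one every worker (firm) weakly prefers to all others. In the constraints, $f'<^{I}_w f$ ranges over firms $w$ ranks below $f$ in $I$, and $w'>^{I}_f w$ over workers $f$ ranks above $w$ in $I$. Rounding: for instance $I$ and worker $w$, split $[0,1]$ into consecutive subintervals of lengths $x_{wf}$ ordered by $w$'s $I$-preference from most to least preferred; $\mu^I_\theta(w)$ is the firm whose subinterval contains $\theta$. *)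

theory Defs
  imports Complex_Main "HOL-Library.FuncSet"
begin

section \<open>Stable matching instances\<close>

text \<open>\<open>wpref I w f f'\<close> means that worker \<open>w\<close> strictly prefers \<open>f\<close> to \<open>f'\<close>;
  \<open>fpref I f w w'\<close> means that firm \<open>f\<close> strictly prefers \<open>w\<close> to \<open>w'\<close>.\<close>

record ('w, 'f) sm_instance =
  wpref :: "'w \<Rightarrow> 'f \<Rightarrow> 'f \<Rightarrow> bool"
  fpref :: "'f \<Rightarrow> 'w \<Rightarrow> 'w \<Rightarrow> bool"

definition strict_total_on :: "'a set \<Rightarrow> ('a \<Rightarrow> 'a \<Rightarrow> bool) \<Rightarrow> bool" where
  "strict_total_on S R \<longleftrightarrow> irreflp_on S R \<and> transp_on S R \<and> totalp_on S R"

definition is_instance :: "'w set \<Rightarrow> 'f set \<Rightarrow> ('w, 'f) sm_instance \<Rightarrow> bool" where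
  "is_instance W F I \<longleftrightarrow>
     (\<forall>w\<in>W. strict_total_on F (wpref I w)) \<and> (\<forall>f\<in>F. strict_total_on W (fpref I f))"

text \<open>Matchings are extensional functions, so that equality of matchings is agreement on \<open>W\<close>.
  The partner of a firm \<open>f\<close> in \<open>M\<close> is \<open>inv_into W M f\<close>.\<close>

definition perfect_matching :: "'w set \<Rightarrow> 'f set \<Rightarrow> ('w \<Rightarrow> 'f) \<Rightarrow> bool" where
  "perfect_matching W F M \<longleftrightarrow> M \<in> extensional W \<and> bij_betw M W F"

definition blocking_pair ::
  "'w set \<Rightarrow> 'f set \<Rightarrow> ('w, 'f) sm_instance \<Rightarrow> ('w \<Rightarrow> 'f) \<Rightarrow> 'w \<Rightarrow> 'f \<Rightarrow> bool" where
  "blocking_pair W F I M w f \<longleftrightarrow>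
     w \<in> W \<and> f \<in> F \<and> M w \<noteq> f \<and> wpref I w f (M w) \<and> fpref I f w (inv_into W M f)"

definition stable_matchings ::
  "'w set \<Rightarrow> 'f set \<Rightarrow> ('w, 'f) sm_instance \<Rightarrow> ('w \<Rightarrow> 'f) set" where
  "stable_matchings W F I =
     {M. perfect_matching W F M \<and> (\<forall>w f. \<not> blocking_pair W F I M w f)}"

definition common_stable ::
  "'w set \<Rightarrow> 'f set \<Rightarrow> nat \<Rightarrow> (nat \<Rightarrow> ('w, 'f) sm_instance) \<Rightarrow> ('w \<Rightarrow> 'f) set" where
  "common_stable W F k A = (\<Inter>i<k. stable_matchings W F (A i))"

definition match_join ::
  "'w set \<Rightarrow> ('w, 'f) sm_instance \<Rightarrow> ('w \<Rightarrow> 'f) \<Rightarrow> ('w \<Rightarrow> 'f) \<Rightarrow> 'w \<Rightarrow> 'f" where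
  "match_join W I M M' = (\<lambda>w\<in>W. if wpref I w (M w) (M' w) then M' w else M w)"

definition match_meet ::
  "'w set \<Rightarrow> ('w, 'f) sm_instance \<Rightarrow> ('w \<Rightarrow> 'f) \<Rightarrow> ('w \<Rightarrow> 'f) \<Rightarrow> 'w \<Rightarrow> 'f" where
  "match_meet W I M M' = (\<lambda>w\<in>W. if wpref I w (M w) (M' w) then M w else M' w)"

definition sublattice ::
  "'w set \<Rightarrow> 'f set \<Rightarrow> ('w, 'f) sm_instance \<Rightarrow> ('w \<Rightarrow> 'f) set \<Rightarrow> bool" where
  "sublattice W F I L \<longleftrightarrow> L \<subseteq> stable_matchings W F I \<and>
     (\<forall>M\<in>L. \<forall>M'\<in>L. match_join W I M M' \<in> L \<and> match_meet W I M M' \<in> L)"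

definition worker_optimal ::
  "'w set \<Rightarrow> ('w, 'f) sm_instance \<Rightarrow> ('w \<Rightarrow> 'f) set \<Rightarrow> ('w \<Rightarrow> 'f) \<Rightarrow> bool" where
  "worker_optimal W I L M \<longleftrightarrow>
     M \<in> L \<and> (\<forall>M'\<in>L. \<forall>w\<in>W. M w = M' w \<or> wpref I w (M w) (M' w))"

definition firm_optimal ::
  "'w set \<Rightarrow> 'f set \<Rightarrow> ('w, 'f) sm_instance \<Rightarrow> ('w \<Rightarrow> 'f) set \<Rightarrow> ('w \<Rightarrow> 'f) \<Rightarrow> bool" where
  "firm_optimal W F I L M \<longleftrightarrow>
     M \<in> L \<and> (\<forall>M'\<in>L. \<forall>f\<in>F. inv_into W M f = inv_into W M' f \<or>
                            fpref I f (inv_into W M f) (inv_into W M' f))"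

text \<open>The instances of a family are \<open>A 0, \<dots>, A (k - 1)\<close>.\<close>

definition one_worker_family ::
  "'w set \<Rightarrow> 'f set \<Rightarrow> nat \<Rightarrow> (nat \<Rightarrow> ('w, 'f) sm_instance) \<Rightarrow> bool" where
  "one_worker_family W F k A \<longleftrightarrow>
     finite W \<and> finite F \<and> card W = card F \<and> 0 < k \<and> (\<forall>i<k. is_instance W F (A i)) \<and>
     (\<exists>w0\<in>W. \<forall>w\<in>W - {w0}. \<forall>i<k. \<forall>j<k. \<forall>f\<in>F. \<forall>f'\<in>F.
        wpref (A i) w f f' \<longleftrightarrow> wpref (A j) w f f')"


section \<open>The linear system and the rounding\<close>

definition feasible ::
  "'w set \<Rightarrow> 'f set \<Rightarrow> nat \<Rightarrow> (nat \<Rightarrow> ('w, 'f) sm_instance) \<Rightarrow> ('w \<Rightarrow> 'f \<Rightarrow> real) \<Rightarrow> bool" where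
  "feasible W F k A x \<longleftrightarrow>
     (\<forall>w\<in>W. (\<Sum>f\<in>F. x w f) = 1) \<and>
     (\<forall>f\<in>F. (\<Sum>w\<in>W. x w f) = 1) \<and>
     (\<forall>i<k. \<forall>w\<in>W. \<forall>f\<in>F.
        (\<Sum>f'\<in>{f'\<in>F. wpref (A i) w f f'}. x w f')
          - (\<Sum>w'\<in>{w'\<in>W. fpref (A i) f w' w}. x w' f) \<le> 0) \<and>
     (\<forall>w\<in>W. \<forall>f\<in>F. 0 \<le> x w f)"

definition left_end ::
  "'f set \<Rightarrow> ('w, 'f) sm_instance \<Rightarrow> ('w \<Rightarrow> 'f \<Rightarrow> real) \<Rightarrow> 'w \<Rightarrow> 'f \<Rightarrow> real" where
  "left_end F I x w f = (\<Sum>f'\<in>{f'\<in>F. wpref I w f' f}. x w f')"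

definition right_end ::
  "'f set \<Rightarrow> ('w, 'f) sm_instance \<Rightarrow> ('w \<Rightarrow> 'f \<Rightarrow> real) \<Rightarrow> 'w \<Rightarrow> 'f \<Rightarrow> real" where
  "right_end F I x w f = left_end F I x w f + x w f"

definition endpoints ::
  "'w set \<Rightarrow> 'f set \<Rightarrow> ('w, 'f) sm_instance \<Rightarrow> ('w \<Rightarrow> 'f \<Rightarrow> real) \<Rightarrow> real set" where
  "endpoints W F I x = (\<Union>w\<in>W. \<Union>f\<in>F. {left_end F I x w f, right_end F I x w f})"

text \<open>The description below is meaningful only when \<open>\<theta>\<close> is not an endpoint: an endpoint lies in
  several of the closed subintervals.\<close>

definition rounding ::
  "'w set \<Rightarrow> 'f set \<Rightarrow> ('w, 'f) sm_instance \<Rightarrow> ('w \<Rightarrow> 'f \<Rightarrow> real) \<Rightarrow> real \<Rightarrow> 'w \<Rightarrow> 'f" where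
  "rounding W F I x \<theta> =
     (\<lambda>w\<in>W. THE f. f \<in> F \<and> \<theta> \<in> {left_end F I x w f .. right_end F I x w f})"


section \<open>A machine model with running time\<close>

text \<open>Polynomial time is measured on structured random access programs whose memory consists of
  arrays of natural numbers with tuples of naturals as indices; a scalar is an array accessed with
  the empty tuple. Each syntax node that is executed or evaluated costs one unit. The only
  arithmetic operations are addition and truncated subtraction: without multiplication a run of
  \<open>t\<close> steps of a fixed program, started with numbers of \<open>b\<close> bits, produces only numbers of
  \<open>O(b + t)\<close> bits, so this unit-cost measure agrees with Turing machine time up to a
  polynomial.\<close>

type_synonym store = "string \<Rightarrow> nat list \<Rightarrow> nat"

datatype expr =
    Const nat
  | Cell string "expr list"
  | Add expr expr
  | Sub expr expr

fun eval :: "expr \<Rightarrow> store \<Rightarrow> nat" where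
  "eval (Const c) s = c"
| "eval (Cell v es) s = s v (map (\<lambda>e. eval e s) es)"
| "eval (Add a b) s = eval a s + eval b s"
| "eval (Sub a b) s = eval a s - eval b s"

fun expr_cost :: "expr \<Rightarrow> nat" where
  "expr_cost (Const c) = 1"
| "expr_cost (Cell v es) = 1 + sum_list (map expr_cost es)"
| "expr_cost (Add a b) = 1 + expr_cost a + expr_cost b"
| "expr_cost (Sub a b) = 1 + expr_cost a + expr_cost b"

datatype prog =
    Skip
  | Assign string "expr list" expr
  | Seq prog prog
  | If expr prog prog
  | While expr prog

text \<open>\<open>exec p s t s'\<close>: program \<open>p\<close> started in \<open>s\<close> halts in \<open>s'\<close> after time \<open>t\<close>.
  A test succeeds iff its value is nonzero.\<close>

inductive exec :: "prog \<Rightarrow> store \<Rightarrow> nat \<Rightarrow> store \<Rightarrow> bool" where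
  exec_Skip: "exec Skip s 1 s"
| exec_Assign:
    "exec (Assign v es e) s (1 + sum_list (map expr_cost es) + expr_cost e)
       (s(v := (s v)(map (\<lambda>a. eval a s) es := eval e s)))"
| exec_Seq:
    "exec p s t s' \<Longrightarrow> exec q s' u s'' \<Longrightarrow> exec (Seq p q) s (1 + t + u) s''"
| exec_IfTrue:
    "eval e s \<noteq> 0 \<Longrightarrow> exec p s t s' \<Longrightarrow> exec (If e p q) s (1 + expr_cost e + t) s'"
| exec_IfFalse:
    "eval e s = 0 \<Longrightarrow> exec q s t s' \<Longrightarrow> exec (If e p q) s (1 + expr_cost e + t) s'"
| exec_WhileFalse:
    "eval e s = 0 \<Longrightarrow> exec (While e p) s (1 + expr_cost e) s"
| exec_WhileTrue:
    "eval e s \<noteq> 0 \<Longrightarrow> exec p s t s' \<Longrightarrow> exec (While e p) s' u s'' \<Longrightarrow>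
     exec (While e p) s (1 + expr_cost e + t + u) s''"

inductive_cases exec_SkipE: "exec Skip s t s'"
inductive_cases exec_AssignE: "exec (Assign v es e) s t s'"
inductive_cases exec_SeqE: "exec (Seq p q) s t s'"
inductive_cases exec_IfE: "exec (If e p q) s t s'"
inductive_cases exec_WhileE: "exec (While e p) s t s'"

lemma exec_deterministic:
  "exec p s t s' \<Longrightarrow> exec p s u s'' \<Longrightarrow> u = t \<and> s'' = s'"
proof (induction arbitrary: u s'' rule: exec.induct)
  case (exec_Seq p s t s1 q t' s2)
  from exec_Seq.prems show ?case
  proof (rule exec_SeqE)
    fix a s1' b
    assume "u = Suc (a + b)" "exec p s a s1'" "exec q s1' b s''"
    with exec_Seq.IH show ?thesis by (metis plus_1_eq_Suc add_Suc)
  qed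
next
  case (exec_IfTrue e s p t s1 q)
  obtain a where "u = Suc (expr_cost e + a)" "exec p s a s''"
    using exec_IfTrue.prems exec_IfTrue.hyps by (auto elim: exec_IfE)
  with exec_IfTrue.IH show ?case by (metis plus_1_eq_Suc add_Suc)
next
  case (exec_IfFalse e s q t s1 p)
  obtain a where "u = Suc (expr_cost e + a)" "exec q s a s''"
    using exec_IfFalse.prems exec_IfFalse.hyps by (auto elim: exec_IfE)
  with exec_IfFalse.IH show ?case by (metis plus_1_eq_Suc add_Suc)
next
  case (exec_WhileFalse e s p)
  then show ?case by (auto elim: exec_WhileE)
next
  case (exec_WhileTrue e s p t s1 t' s2)
  from exec_WhileTrue.prems show ?case
  proof (rule exec_WhileE)
    assume "eval e s = 0"
    with exec_WhileTrue.hyps show ?thesis by simp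
  next
    fix a s1' b
    assume "u = Suc (expr_cost e + a + b)" "exec p s a s1'" "exec (While e p) s1' b s''"
    with exec_WhileTrue.IH show ?thesis by (metis plus_1_eq_Suc add_Suc)
  qed
qed (auto elim: exec_SkipE exec_AssignE)


section \<open>Input and output of programs\<close>

text \<open>For algorithms the agents on either side are \<open>0, \<dots>, n - 1\<close>. The input consists of \<open>n\<close>,
  \<open>k\<close> and the ranking tables of all agents in all instances (rank \<open>0\<close> is the most preferred
  partner); all other cells are initially \<open>0\<close>.\<close>

definition pref_rank :: "nat \<Rightarrow> (nat \<Rightarrow> nat \<Rightarrow> bool) \<Rightarrow> nat \<Rightarrow> nat" where
  "pref_rank n R a = card {b. b < n \<and> R b a}"

definition input :: "nat \<Rightarrow> nat \<Rightarrow> (nat \<Rightarrow> (nat, nat) sm_instance) \<Rightarrow> store" where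
  "input n k A v idx =
     (if v = ''n'' \<and> idx = [] then n
      else if v = ''k'' \<and> idx = [] then k
      else if v = ''wrank'' then
        (case idx of
           [i, w, f] \<Rightarrow> if i < k \<and> w < n \<and> f < n then pref_rank n (wpref (A i) w) f else 0
         | _ \<Rightarrow> 0)
      else if v = ''frank'' then
        (case idx of
           [i, f, w] \<Rightarrow> if i < k \<and> f < n \<and> w < n then pref_rank n (fpref (A i) f) w else 0
         | _ \<Rightarrow> 0)
      else 0)"

definition output_matching :: "nat \<Rightarrow> store \<Rightarrow> string \<Rightarrow> nat \<Rightarrow> nat" where
  "output_matching n s v = (\<lambda>w\<in>{..<n}. s v [w])"

text \<open>Within the time bound, \<open>p\<close> reports whether a common stable matching exists, and if so outputs
  the worker-optimal and the firm-optimal one; these are required to be optimal with respect to the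
  preferences in every instance.\<close>

definition finds_optimal_matchings :: "prog \<Rightarrow> (nat \<Rightarrow> nat \<Rightarrow> nat) \<Rightarrow> bool" where
  "finds_optimal_matchings p T \<longleftrightarrow>
     (\<forall>n k A. one_worker_family {..<n} {..<n} k A \<longrightarrow>
       (\<exists>t s. exec p (input n k A) t s \<and> t \<le> T n k \<and>
          (let L = common_stable {..<n} {..<n} k A in
             if L = {} then s ''found'' [] = 0
             else s ''found'' [] = 1 \<and>
                  (\<forall>i<k. worker_optimal {..<n} (A i) L (output_matching n s ''wopt'') \<and>
                         firm_optimal {..<n} {..<n} (A i) L (output_matching n s ''fopt'')))))"

end

theory Submission
  imports Defs
begin

text \<open>A perfect matching is determined by the partners of all workers but one, so the joins (and
  meets) of two common stable matchings taken in \<open>A\<^sub>1, \<dots>, A\<^sub>k\<close>, which agree on the \<open>n - 1\<close>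
  common workers, coincide; the same argument identifies the rounded matchings once each of them
  is known to be stable. For the latter, weighting the stability constraints by \<open>x\<close> and summing
  shows that they are tight on the support of \<open>x\<close>. Hence the subinterval of \<open>f\<close> for \<open>w\<close> is
  also the subinterval of \<open>w\<close> for \<open>f\<close> when firms order \<open>[0, 1]\<close> from least to most preferred
  worker, and stability can be read off at \<open>\<theta>\<close>.

  The algorithm is combinatorial. Guess the exceptional worker \<open>v\<close>, her partner (of rank \<open>r\<close>), and
  for one worker \<open>u\<close> a rank \<open>q\<close> above which her partner must not lie. Let every other worker point
  to her favourite firm and advance a pointer whenever some instance shows that no common
  stable matching respecting the guess uses it; at most \<open>n\<^sup>2\<close> rounds lead to the best such
  matching, or reveal that there is none. Since common stable matchings form a lattice, the
  worker-optimal one consists of the best, and the firm-optimal one of the worst partners found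
  over all guesses.\<close>

section \<open>Strict total orders and the preferences of an instance\<close>

lemma strict_total_onD:
  assumes "strict_total_on S R"
  shows "x \<in> S \<Longrightarrow> \<not> R x x"
    and "x \<in> S \<Longrightarrow> y \<in> S \<Longrightarrow> z \<in> S \<Longrightarrow> R x y \<Longrightarrow> R y z \<Longrightarrow> R x z"
    and "x \<in> S \<Longrightarrow> y \<in> S \<Longrightarrow> x \<noteq> y \<Longrightarrow> R x y \<or> R y x"
    and "x \<in> S \<Longrightarrow> y \<in> S \<Longrightarrow> R x y \<Longrightarrow> \<not> R y x"
proof -
  show irr: "x \<in> S \<Longrightarrow> \<not> R x x" for x
    using assms by (auto simp: strict_total_on_def dest: irreflp_onD)
  show tr: "x \<in> S \<Longrightarrow> y \<in> S \<Longrightarrow> z \<in> S \<Longrightarrow> R x y \<Longrightarrow> R y z \<Longrightarrow> R x z" for x y z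
    using assms unfolding strict_total_on_def by (blast dest: transp_onD)
  show "x \<in> S \<Longrightarrow> y \<in> S \<Longrightarrow> x \<noteq> y \<Longrightarrow> R x y \<or> R y x"
    using assms unfolding strict_total_on_def by (blast dest: totalp_onD)
  show "x \<in> S \<Longrightarrow> y \<in> S \<Longrightarrow> R x y \<Longrightarrow> \<not> R y x"
    using irr tr by blast
qed

lemma is_instanceD:
  assumes "is_instance W F I"
  shows "w \<in> W \<Longrightarrow> strict_total_on F (wpref I w)" "f \<in> F \<Longrightarrow> strict_total_on W (fpref I f)"
  using assms by (auto simp: is_instance_def)

section \<open>The lattice of stable matchings\<close>

text \<open>Total preferences of the firms turn injectivity into another instance of the
  pairwise condition, so that bijectivity need not be assumed on the right-hand side.\<close>

lemma stable_matchings_iff: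
  assumes fin: "finite W" "finite F" and card: "card W = card F" and I: "is_instance W F I"
  shows "M \<in> stable_matchings W F I \<longleftrightarrow> M \<in> W \<rightarrow>\<^sub>E F \<and>
    (\<forall>a\<in>W. \<forall>b\<in>W. fpref I (M a) b a \<longrightarrow> M a \<noteq> M b \<and> \<not> wpref I b (M a) (M b))"
    (is "?L \<longleftrightarrow> ?M \<and> ?R")
proof
  assume L: ?L
  then have ext: "M \<in> extensional W" and bij: "bij_betw M W F"
    and nb: "\<And>w f. \<not> blocking_pair W F I M w f"
    by (auto simp: stable_matchings_def perfect_matching_def)
  have M: ?M using ext bij by (auto simp: PiE_def dest: bij_betwE)
  moreover have ?R
  proof (intro ballI impI)
    fix a b assume ab: "a \<in> W" "b \<in> W" and pr: "fpref I (M a) b a"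
    have Fa: "M a \<in> F" using M ab by auto
    have "a \<noteq> b" using strict_total_onD(1)[OF is_instanceD(2)[OF I Fa]] ab pr by auto
    then have ne: "M a \<noteq> M b"
      using bij ab by (auto simp: bij_betw_def dest: inj_onD)
    have inv: "inv_into W M (M a) = a"
      using bij ab by (simp add: bij_betw_inv_into_left)
    show "M a \<noteq> M b \<and> \<not> wpref I b (M a) (M b)"
      using nb[of b "M a"] ne ab Fa pr inv by (auto simp: blocking_pair_def)
  qed
  ultimately show "?M \<and> ?R" by blast
next
  assume A: "?M \<and> ?R"
  have inj: "inj_on M W"
  proof (rule inj_onI, rule ccontr)
    fix a b assume "a \<in> W" "b \<in> W" "M a = M b" "a \<noteq> b"
    moreover from this have "fpref I (M a) b a \<or> fpref I (M a) a b"
      using A strict_total_onD(3)[OF is_instanceD(2)[OF I, of "M a"]] by blast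
    ultimately show False using A by metis
  qed
  have bij: "bij_betw M W F"
  proof -
    have "M ` W \<subseteq> F" using A by auto
    moreover have "card (M ` W) = card F" using card card_image[OF inj] by simp
    ultimately have "M ` W = F" using fin by (simp add: card_subset_eq)
    then show ?thesis using inj by (simp add: bij_betw_def)
  qed
  have "\<not> blocking_pair W F I M w f" for w f
  proof
    assume "blocking_pair W F I M w f"
    then have b: "w \<in> W" "f \<in> F" "wpref I w f (M w)" "fpref I f w (inv_into W M f)"
      by (auto simp: blocking_pair_def)
    have "inv_into W M f \<in> W" "M (inv_into W M f) = f"
      using bij b by (auto simp: bij_betw_def f_inv_into_f inv_into_into)
    then show False using A b by metis
  qed
  then show ?L using A bij by (auto simp: stable_matchings_def perfect_matching_def PiE_def)
qed

section \<open>Perfect matchings that agree off one worker\<close>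

lemma stable_matchings_perfect:
  "M \<in> stable_matchings W F I \<Longrightarrow> perfect_matching W F M"
  by (simp add: stable_matchings_def)

text \<open>If \<open>N\<close> gave the firm \<open>M w0\<close> to some \<open>v\<close> other
  than \<open>w0\<close>, then \<open>M v = N v = M w0\<close> would contradict the injectivity of
  \<open>M\<close>.\<close>

lemma perfect_matching_eqI:
  assumes M: "perfect_matching W F M" and N: "perfect_matching W F N"
    and eq: "\<And>w. w \<in> W \<Longrightarrow> w \<noteq> w0 \<Longrightarrow> M w = N w"
  shows "M = N"
proof (rule extensionalityI)
  show "M \<in> extensional W" "N \<in> extensional W"
    using M N by (auto simp: perfect_matching_def)
  have bM: "bij_betw M W F" and bN: "bij_betw N W F"
    using M N by (auto simp: perfect_matching_def)
  fix w assume w: "w \<in> W"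
  show "M w = N w"
  proof (cases "w = w0")
    case True
    have "M w \<in> N ` W" using bM bN w by (auto simp: bij_betw_def)
    then obtain v where v: "v \<in> W" "M w = N v" by blast
    show ?thesis
    proof (cases "v = w0")
      case False
      then have "M w = M v" using eq v by simp
      then have "w = v" using bM w v inj_onD[of M W w v] by (simp add: bij_betw_def)
      then show ?thesis using True False by simp
    qed (use v True in simp)
  qed (use eq w in simp)
qed

section \<open>Meet and join in a single instance\<close>

locale matching_instance =
  fixes W :: "'w set" and F :: "'f set" and I :: "('w, 'f) sm_instance"
  assumes finite_W: "finite W" and finite_F: "finite F" and card_eq: "card W = card F"
    and inst: "is_instance W F I"
begin

lemmas w_order = strict_total_onD[OF is_instanceD(1)[OF inst]]
lemmas f_order = strict_total_onD[OF is_instanceD(2)[OF inst]]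
lemmas stable_iff = stable_matchings_iff[OF finite_W finite_F card_eq inst]

lemma stable_in: "M \<in> stable_matchings W F I \<Longrightarrow> w \<in> W \<Longrightarrow> M w \<in> F"
  by (auto simp: stable_iff)

text \<open>This and \<open>stable_firm_prefers\<close> are the two contrapositives of non-blocking
  on which the exchange arguments rest; totality turns a negated preference into a strict one the
  other way.\<close>

lemma stableD:
  assumes "M \<in> stable_matchings W F I" "a \<in> W" "b \<in> W" "fpref I (M a) b a"
  shows "wpref I b (M b) (M a)"
  using assms w_order(3)[of b "M a" "M b"] by (auto simp: stable_iff)

lemma stable_firm_prefers:
  assumes M: "M \<in> stable_matchings W F I" and a: "a \<in> W" and b: "b \<in> W"
    and pr: "wpref I b (M a) (M b)"
  shows "fpref I (M a) a b"
proof -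
  have F: "M a \<in> F" "M b \<in> F" using stable_in[OF M] a b by auto
  then have "M a \<noteq> M b" using pr w_order(1)[OF b] by auto
  then have "a \<noteq> b" by auto
  moreover have "\<not> fpref I (M a) b a" using M a b pr by (auto simp: stable_iff)
  ultimately show ?thesis using f_order(3)[OF F(1) a b] by blast
qed

text \<open>Totality replaces the one-sided test in the definition by a symmetric case
  distinction.\<close>

lemma match_meet_cases:
  assumes M: "M \<in> stable_matchings W F I" and M': "M' \<in> stable_matchings W F I" and w: "w \<in> W"
  shows "match_meet W I M M' w = M w \<and> (M w = M' w \<or> wpref I w (M w) (M' w)) \<or>
    match_meet W I M M' w = M' w \<and> wpref I w (M' w) (M w)"
  using w_order(3)[OF w stable_in[OF M w] stable_in[OF M' w]] w
  by (cases "M w = M' w") (auto simp: match_meet_def)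

lemma match_join_cases:
  assumes M: "M \<in> stable_matchings W F I" and M': "M' \<in> stable_matchings W F I" and w: "w \<in> W"
  shows "match_join W I M M' w = M w \<and> (M w = M' w \<or> wpref I w (M' w) (M w)) \<or>
    match_join W I M M' w = M' w \<and> wpref I w (M w) (M' w)"
  using w_order(3)[OF w stable_in[OF M w] stable_in[OF M' w]] w
  by (cases "M w = M' w") (auto simp: match_join_def)

lemma match_meet_stable:
  assumes M: "M \<in> stable_matchings W F I" and M': "M' \<in> stable_matchings W F I"
  shows "match_meet W I M M' \<in> stable_matchings W F I"
proof -
  let ?J = "match_meet W I M M'"
  have "?J \<in> W \<rightarrow>\<^sub>E F"
    using stable_in[OF M] stable_in[OF M'] by (auto simp: match_meet_def)
  moreover have "?J a \<noteq> ?J b \<and> \<not> wpref I b (?J a) (?J b)"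
    if ab: "a \<in> W" "b \<in> W" and pr: "fpref I (?J a) b a" for a b
  proof -
    have F: "M a \<in> F" "M' a \<in> F" "M b \<in> F" "M' b \<in> F"
      using stable_in[OF M] stable_in[OF M'] ab by auto
    \<comment> \<open>Whichever of \<open>M\<close> and \<open>M'\<close> gives \<open>a\<close> its
      firm, \<open>b\<close> prefers its own partner in that matching to the firm, and the meet is
      at least as good for \<open>b\<close>. Injectivity is covered by
      \<open>stable_iff\<close>.\<close>
    have "wpref I b (?J b) (?J a)"
      using match_meet_cases[OF M M' ab(1)] match_meet_cases[OF M M' ab(2)] pr
        stableD[OF M ab] stableD[OF M' ab] w_order(2)[OF ab(2)] F by metis
    then show ?thesis
      using w_order(4)[OF ab(2)] w_order(1)[OF ab(2)] match_meet_cases[OF M M' ab(1)]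
        match_meet_cases[OF M M' ab(2)] F by metis
  qed
  ultimately show ?thesis by (simp add: stable_iff)
qed

text \<open>The join is onto: if it gave a firm to neither of the firm's two partners, both would like
  this firm better than their other one, and each of the two stable matchings would force the
  firm to rank its own worker first.\<close>

lemma match_join_perfect:
  assumes M: "M \<in> stable_matchings W F I" and M': "M' \<in> stable_matchings W F I"
  shows "perfect_matching W F (match_join W I M M')"
proof -
  let ?J = "match_join W I M M'"
  have bM: "M ` W = F" and bM': "M' ` W = F"
    using stable_matchings_perfect[OF M] stable_matchings_perfect[OF M']
    by (auto simp: perfect_matching_def bij_betw_def)
  have "F \<subseteq> ?J ` W"
  proof
    fix f assume f: "f \<in> F"
    obtain a where a: "a \<in> W" "M a = f" using bM f by auto
    obtain b where b: "b \<in> W" "M' b = f" using bM' f by auto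
    show "f \<in> ?J ` W"
    proof (rule ccontr)
      assume "f \<notin> ?J ` W"
      then have ne: "?J a \<noteq> f" "?J b \<noteq> f" using a(1) b(1) by (metis imageI)+
      have "wpref I a (M a) (M' a)" using match_join_cases[OF M M' a(1)] ne a by auto
      then have "fpref I f b a" using stable_firm_prefers[OF M' b(1) a(1)] a b by auto
      moreover have "wpref I b (M' b) (M b)" using match_join_cases[OF M M' b(1)] ne b by auto
      then have "fpref I f a b" using stable_firm_prefers[OF M a(1) b(1)] a b by auto
      ultimately show False using f_order(4)[OF f] a b by blast
    qed
  qed
  moreover have "?J ` W \<subseteq> F"
    using stable_in[OF M] stable_in[OF M'] by (auto simp: match_join_def)
  ultimately have im: "?J ` W = F" by blast
  then have "inj_on ?J W" using finite_W card_eq by (intro eq_card_imp_inj_on) auto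
  then show ?thesis using im by (auto simp: perfect_matching_def bij_betw_def match_join_def)
qed

lemma match_join_commute_on:
  assumes M: "M \<in> stable_matchings W F I" and M': "M' \<in> stable_matchings W F I"
  shows "match_join W I M M' = match_join W I M' M"
proof (rule extensionalityI)
  fix w assume w: "w \<in> W"
  show "match_join W I M M' w = match_join W I M' M w"
    using w_order(3,4)[OF w stable_in[OF M w] stable_in[OF M' w]] w
    by (auto simp: match_join_def)
qed (auto simp: match_join_def)

text \<open>Half of the stability of the join: \<open>a\<close> keeps its partner from
  \<open>M\<close>. The other half follows by exchanging \<open>M\<close> and \<open>M'\<close>,
  since the join is commutative.\<close>

lemma match_join_stable_aux:
  assumes M: "M \<in> stable_matchings W F I" and M': "M' \<in> stable_matchings W F I"
    and ab: "a \<in> W" "b \<in> W" and pr: "fpref I (match_join W I M M' a) b a"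
    and Ja: "match_join W I M M' a = M a"
  shows "\<not> wpref I b (match_join W I M M' a) (match_join W I M M' b)"
proof
  let ?J = "match_join W I M M'"
  assume bl: "wpref I b (?J a) (?J b)"
  have F: "M a \<in> F" "M' a \<in> F" "M b \<in> F" "M' b \<in> F"
    using stable_in[OF M] stable_in[OF M'] ab by auto
  have "wpref I b (M b) (M a)" using stableD[OF M ab] pr Ja by simp
  then have Jb: "?J b = M' b"
    using match_join_cases[OF M M' ab(2)] bl Ja w_order(4)[OF ab(2)] F by metis
  \<comment> \<open>The firm \<open>M a\<close> has a second partner \<open>c\<close>, the one in
    \<open>M'\<close>. As \<open>b\<close> wants this firm in \<open>M'\<close>, stability of
    \<open>M'\<close> makes the firm rank \<open>c\<close> above \<open>b\<close>.\<close>
  obtain c where c: "c \<in> W" "M' c = M a"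
    using stable_matchings_perfect[OF M'] F by (auto simp: perfect_matching_def bij_betw_def)
  have cb: "fpref I (M a) c b"
    using stable_firm_prefers[OF M' c(1) ab(2)] bl Ja Jb c by simp
  show False
  proof (cases "c = a")
    case True
    then show False using cb pr Ja f_order(4)[OF F(1) ab] by simp
  next
    case False
    \<comment> \<open>The join is injective, so \<open>c\<close> must take its worse partner
      \<open>M c\<close> and wants \<open>M a\<close>; stability of \<open>M\<close> then ranks
      \<open>a\<close> above \<open>c\<close>, hence above \<open>b\<close>.\<close>
    have "?J c \<noteq> ?J a"
      using match_join_perfect[OF M M'] False c ab
      by (auto simp: perfect_matching_def bij_betw_def dest: inj_onD)
    then have "wpref I c (M a) (M c)"
      using match_join_cases[OF M M' c(1)] Ja c by auto
    then have "fpref I (M a) a c" using stable_firm_prefers[OF M ab(1) c(1)] by simp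
    then have "fpref I (M a) a b" using cb f_order(2)[OF F(1)] ab c by blast
    then show False using pr Ja f_order(4)[OF F(1) ab] by simp
  qed
qed

lemma match_join_stable:
  assumes M: "M \<in> stable_matchings W F I" and M': "M' \<in> stable_matchings W F I"
  shows "match_join W I M M' \<in> stable_matchings W F I"
proof -
  let ?J = "match_join W I M M'"
  have perf: "perfect_matching W F ?J" by (rule match_join_perfect[OF M M'])
  then have "?J \<in> W \<rightarrow>\<^sub>E F" by (auto simp: perfect_matching_def PiE_def dest: bij_betwE)
  moreover have "?J a \<noteq> ?J b \<and> \<not> wpref I b (?J a) (?J b)"
    if ab: "a \<in> W" "b \<in> W" and pr: "fpref I (?J a) b a" for a b
  proof
    have "?J a \<in> F" using perf ab by (auto simp: perfect_matching_def dest: bij_betwE)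
    then have "a \<noteq> b" using f_order(1) pr ab by blast
    then show "?J a \<noteq> ?J b"
      using perf ab by (auto simp: perfect_matching_def bij_betw_def dest: inj_onD)
    show "\<not> wpref I b (?J a) (?J b)"
    proof (cases "?J a = M a")
      case True
      then show ?thesis using match_join_stable_aux[OF M M' ab] pr by simp
    next
      case False
      then have "?J a = M' a" using match_join_cases[OF M M' ab(1)] by auto
      then show ?thesis
        using match_join_stable_aux[OF M' M ab] pr match_join_commute_on[OF M M'] by simp
    qed
  qed
  ultimately show ?thesis by (simp add: stable_iff)
qed

text \<open>Opposition of interests: the worker that \<open>f\<close> has in \<open>M'\<close>,
  unless kept, is worse off in \<open>M\<close> and still wants \<open>f\<close>, so non-blocking of
  \<open>M\<close> favours the worker that \<open>f\<close> has there. This turns a worker-pessimal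
  matching into a firm-optimal one.\<close>

lemma firm_prefers_if_workers_dislike:
  assumes M: "M \<in> stable_matchings W F I" and M': "M' \<in> stable_matchings W F I"
    and worse: "\<And>w. w \<in> W \<Longrightarrow> M w = M' w \<or> wpref I w (M' w) (M w)" and f: "f \<in> F"
  shows "inv_into W M f = inv_into W M' f \<or> fpref I f (inv_into W M f) (inv_into W M' f)"
proof -
  let ?a = "inv_into W M f" and ?b = "inv_into W M' f"
  have bM: "bij_betw M W F" and bM': "bij_betw M' W F"
    using stable_matchings_perfect[OF M] stable_matchings_perfect[OF M']
    by (auto simp: perfect_matching_def)
  have a: "?a \<in> W" "M ?a = f" and b: "?b \<in> W" "M' ?b = f"
    using bM bM' f by (auto simp: bij_betw_def f_inv_into_f inv_into_into)
  show ?thesis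
  proof (cases "M ?b = f")
    case True
    then have "?a = ?b" using bM a b inj_onD[of M W ?a ?b] by (simp add: bij_betw_def)
    then show ?thesis by simp
  next
    case False
    then have "wpref I ?b f (M ?b)" using worse[OF b(1)] b by auto
    then show ?thesis using stable_firm_prefers[OF M a(1) b(1)] a by simp
  qed
qed

end

section \<open>Families in which one worker varies\<close>

locale one_worker =
  fixes W :: "'w set" and F :: "'f set" and k :: nat and A :: "nat \<Rightarrow> ('w, 'f) sm_instance"
    and w0 :: 'w
  assumes finW: "finite W" and finF: "finite F" and cardWF: "card W = card F" and k0: "0 < k"
    and insts: "\<And>i. i < k \<Longrightarrow> is_instance W F (A i)"
    and w0: "w0 \<in> W"
    and common: "\<And>w i j f f'. \<lbrakk>w \<in> W; w \<noteq> w0; i < k; j < k; f \<in> F; f' \<in> F\<rbrakk> \<Longrightarrow>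
      wpref (A i) w f f' \<longleftrightarrow> wpref (A j) w f f'"
begin

lemma matching_instance: "i < k \<Longrightarrow> matching_instance W F (A i)"
  using finW finF cardWF insts by unfold_locales auto

lemma common_stableD: "M \<in> common_stable W F k A \<Longrightarrow> i < k \<Longrightarrow> M \<in> stable_matchings W F (A i)"
  by (auto simp: common_stable_def)

lemma common_in: "M \<in> common_stable W F k A \<Longrightarrow> w \<in> W \<Longrightarrow> M w \<in> F"
  using matching_instance.stable_in[OF matching_instance[OF k0] common_stableD[OF _ k0], of M w] by simp

text \<open>Each side is stable in its own instance and therefore perfect, and the tests that define
  the two sides agree for every worker except \<open>w0\<close>.\<close>

lemma common_join_meet_eq:
  assumes M: "M \<in> common_stable W F k A" and M': "M' \<in> common_stable W F k A"
    and ij: "i < k" "j < k"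
  shows "match_join W (A i) M M' = match_join W (A j) M M'"
    and "match_meet W (A i) M M' = match_meet W (A j) M M'"
proof -
  note mi = matching_instance[OF ij(1)] and mj = matching_instance[OF ij(2)]
  note Mi = common_stableD[OF M ij(1)] and M'i = common_stableD[OF M' ij(1)]
    and Mj = common_stableD[OF M ij(2)] and M'j = common_stableD[OF M' ij(2)]
  have eq: "wpref (A i) w (M w) (M' w) \<longleftrightarrow> wpref (A j) w (M w) (M' w)"
    if "w \<in> W" "w \<noteq> w0" for w
    by (rule common[OF that ij common_in[OF M that(1)] common_in[OF M' that(1)]])
  show "match_join W (A i) M M' = match_join W (A j) M M'"
  proof (rule perfect_matching_eqI[where ?w0.0 = w0])
    show "perfect_matching W F (match_join W (A i) M M')"
      "perfect_matching W F (match_join W (A j) M M')"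
      using matching_instance.match_join_stable[OF mi Mi M'i] matching_instance.match_join_stable[OF mj Mj M'j]
      by (auto intro: stable_matchings_perfect)
  qed (auto simp: match_join_def eq)
  show "match_meet W (A i) M M' = match_meet W (A j) M M'"
  proof (rule perfect_matching_eqI[where ?w0.0 = w0])
    show "perfect_matching W F (match_meet W (A i) M M')"
      "perfect_matching W F (match_meet W (A j) M M')"
      using matching_instance.match_meet_stable[OF mi Mi M'i] matching_instance.match_meet_stable[OF mj Mj M'j]
      by (auto intro: stable_matchings_perfect)
  qed (auto simp: match_meet_def eq)
qed

text \<open>Stability in \<open>A j\<close> is known for the join or meet taken in
  \<open>A j\<close>, which is the same matching as the one taken in \<open>A i\<close>.\<close>

lemma common_closed:
  assumes M: "M \<in> common_stable W F k A" and M': "M' \<in> common_stable W F k A" and i: "i < k"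
  shows "match_join W (A i) M M' \<in> common_stable W F k A"
    and "match_meet W (A i) M M' \<in> common_stable W F k A"
proof -
  have "match_join W (A i) M M' \<in> stable_matchings W F (A j)" if "j < k" for j
    using common_join_meet_eq(1)[OF M M' i that]
      matching_instance.match_join_stable[OF matching_instance[OF that] common_stableD[OF M that]
        common_stableD[OF M' that]]
    by simp
  then show "match_join W (A i) M M' \<in> common_stable W F k A" by (auto simp: common_stable_def)
  have "match_meet W (A i) M M' \<in> stable_matchings W F (A j)" if "j < k" for j
    using common_join_meet_eq(2)[OF M M' i that]
      matching_instance.match_meet_stable[OF matching_instance[OF that] common_stableD[OF M that]
        common_stableD[OF M' that]]
    by simp
  then show "match_meet W (A i) M M' \<in> common_stable W F k A" by (auto simp: common_stable_def)
qed

lemma sublattice_common: "i < k \<Longrightarrow> sublattice W F (A i) (common_stable W F k A)"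
  using common_closed[of _ _ i] common_stableD[of _ i] by (simp add: sublattice_def subset_iff)

end

lemma one_worker_familyE:
  assumes "one_worker_family W F k A"
  obtains w0 where "one_worker W F k A w0"
proof -
  from assms obtain w0 where "w0 \<in> W" "\<forall>w\<in>W - {w0}. \<forall>i<k. \<forall>j<k. \<forall>f\<in>F. \<forall>f'\<in>F.
      wpref (A i) w f f' \<longleftrightarrow> wpref (A j) w f f'"
    unfolding one_worker_family_def by blast
  then have "one_worker W F k A w0"
    using assms unfolding one_worker_family_def by unfold_locales blast+
  then show thesis by (rule that)
qed

section \<open>Rounding a fractional solution\<close>

text \<open>Expand the square over ordered pairs: pairs with \<open>R b a\<close> and pairs with
  \<open>R a b\<close> contribute equally. For a row or column of total mass 1, this evaluates the
  weighted cumulative masses independently of the order.\<close>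

lemma sum_square_split:
  fixes x :: "'a \<Rightarrow> real"
  assumes fin: "finite S" and R: "strict_total_on S R"
  shows "2 * (\<Sum>a\<in>S. x a * (\<Sum>b\<in>{b\<in>S. R b a}. x b)) + (\<Sum>a\<in>S. x a * x a) = (\<Sum>a\<in>S. x a)\<^sup>2"
proof -
  have split: "(\<Sum>b\<in>S. x b) = (\<Sum>b\<in>{b\<in>S. R b a}. x b) + (\<Sum>b\<in>{b\<in>S. R a b}. x b) + x a"
    if a: "a \<in> S" for a
  proof -
    have "S = insert a ({b\<in>S. R b a} \<union> {b\<in>S. R a b})"
      using strict_total_onD(3)[OF R a] a by auto
    then have "(\<Sum>b\<in>S. x b) = sum x (insert a ({b\<in>S. R b a} \<union> {b\<in>S. R a b}))" by simp
    also have "\<dots> = x a + sum x ({b\<in>S. R b a} \<union> {b\<in>S. R a b})"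
      using fin strict_total_onD(1)[OF R a] by (subst sum.insert) auto
    also have "sum x ({b\<in>S. R b a} \<union> {b\<in>S. R a b}) = sum x {b\<in>S. R b a} + sum x {b\<in>S. R a b}"
      using fin strict_total_onD(4)[OF R a] by (subst sum.union_disjoint) auto
    finally show ?thesis by simp
  qed
  have swap: "(\<Sum>a\<in>S. x a * (\<Sum>b\<in>{b\<in>S. R a b}. x b)) = (\<Sum>a\<in>S. x a * (\<Sum>b\<in>{b\<in>S. R b a}. x b))"
  proof -
    have "(\<Sum>a\<in>S. x a * (\<Sum>b\<in>{b\<in>S. R a b}. x b)) = (\<Sum>a\<in>S. \<Sum>b\<in>{b\<in>S. R a b}. x a * x b)"
      by (simp add: sum_distrib_left)
    also have "\<dots> = (\<Sum>b\<in>S. \<Sum>a\<in>{a\<in>S. R a b}. x a * x b)"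
      using sum.swap_restrict[OF fin fin, of "\<lambda>a b. x a * x b" R] by simp
    also have "\<dots> = (\<Sum>a\<in>S. x a * (\<Sum>b\<in>{b\<in>S. R b a}. x b))"
      by (simp add: sum_distrib_left mult.commute)
    finally show ?thesis .
  qed
  have "(\<Sum>a\<in>S. x a)\<^sup>2 = (\<Sum>a\<in>S. x a * (\<Sum>b\<in>S. x b))"
    by (simp add: power2_eq_square sum_distrib_right)
  also have "\<dots> = (\<Sum>a\<in>S. x a * (\<Sum>b\<in>{b\<in>S. R b a}. x b) + x a * (\<Sum>b\<in>{b\<in>S. R a b}. x b) + x a * x a)"
    by (rule sum.cong[OF refl]) (simp add: split algebra_simps)
  finally show ?thesis by (simp add: sum.distrib swap)
qed

locale fractional_stable = matching_instance W F I
  for W :: "'w set" and F :: "'f set" and I :: "('w, 'f) sm_instance" +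
  fixes x :: "'w \<Rightarrow> 'f \<Rightarrow> real"
  assumes row: "\<And>w. w \<in> W \<Longrightarrow> (\<Sum>f\<in>F. x w f) = 1"
    and col: "\<And>f. f \<in> F \<Longrightarrow> (\<Sum>w\<in>W. x w f) = 1"
    and stab: "\<And>w f. w \<in> W \<Longrightarrow> f \<in> F \<Longrightarrow>
        (\<Sum>f'\<in>{f'\<in>F. wpref I w f f'}. x w f') \<le> (\<Sum>w'\<in>{w'\<in>W. fpref I f w' w}. x w' f)"
    and nonneg: "\<And>w f. w \<in> W \<Longrightarrow> f \<in> F \<Longrightarrow> 0 \<le> x w f"
begin

abbreviation lft :: "'w \<Rightarrow> 'f \<Rightarrow> real" where "lft \<equiv> left_end F I x"
abbreviation rgt :: "'w \<Rightarrow> 'f \<Rightarrow> real" where "rgt \<equiv> right_end F I x"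

text \<open>If \<open>f\<close> orders [0, 1] from its least to its most preferred worker, the
  subinterval of \<open>w\<close> ends at \<open>1 - above w f\<close>.\<close>

definition above :: "'w \<Rightarrow> 'f \<Rightarrow> real" where
  "above w f = (\<Sum>w'\<in>{w'\<in>W. fpref I f w' w}. x w' f)"

text \<open>The mass on firms that \<open>w\<close> ranks below \<open>f\<close> is what remains to
  the right of the subinterval of \<open>f\<close>, so this is the stability constraint expressed by
  endpoints.\<close>

lemma above_ge:
  assumes w: "w \<in> W" and f: "f \<in> F"
  shows "1 - rgt w f \<le> above w f"
proof -
  have "F = insert f ({f'\<in>F. wpref I w f' f} \<union> {f'\<in>F. wpref I w f f'})"
    using w_order(3)[OF w f] f by auto
  then have "(\<Sum>f'\<in>F. x w f') = sum (x w) (insert f ({f'\<in>F. wpref I w f' f} \<union> {f'\<in>F. wpref I w f f'}))"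
    by simp
  also have "\<dots> = x w f + sum (x w) ({f'\<in>F. wpref I w f' f} \<union> {f'\<in>F. wpref I w f f'})"
    using finite_F w_order(1)[OF w f] by (subst sum.insert) auto
  also have "sum (x w) ({f'\<in>F. wpref I w f' f} \<union> {f'\<in>F. wpref I w f f'}) =
      sum (x w) {f'\<in>F. wpref I w f' f} + sum (x w) {f'\<in>F. wpref I w f f'}"
    using finite_F w_order(4)[OF w f] by (subst sum.union_disjoint) auto
  finally have "1 - rgt w f = sum (x w) {f'\<in>F. wpref I w f f'}"
    using row[OF w] by (simp add: right_end_def left_end_def)
  then show ?thesis using stab[OF w f] by (simp add: above_def)
qed

text \<open>Weighting the stability constraints by \<open>x\<close> and summing gives an identity, since both sides
  of the market contribute \<open>n / 2\<close>; so the constraints on the support are tight.\<close>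

lemma above_eq:
  assumes w: "w \<in> W" and f: "f \<in> F" and pos: "0 < x w f"
  shows "above w f = 1 - rgt w f"
proof -
  \<comment> \<open>The slack of the constraint for \<open>w\<close> and \<open>f\<close>, weighted
    by \<open>x w f\<close>.\<close>
  define g where "g w f = x w f * (lft w f + x w f + above w f - 1)" for w f
  have W2: "2 * (\<Sum>f\<in>F. x w f * lft w f) + (\<Sum>f\<in>F. x w f * x w f) = 1" if "w \<in> W" for w
    using sum_square_split[OF finite_F is_instanceD(1)[OF inst that], of "x w"] row[OF that]
    by (simp add: left_end_def)
  have F2: "2 * (\<Sum>w\<in>W. x w f * above w f) + (\<Sum>w\<in>W. x w f * x w f) = 1" if "f \<in> F" for f
    using sum_square_split[OF finite_W is_instanceD(2)[OF inst that], of "\<lambda>w. x w f"] col[OF that]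
    by (simp add: above_def)
  have a: "2 * (\<Sum>w\<in>W. \<Sum>f\<in>F. x w f * lft w f) + (\<Sum>w\<in>W. \<Sum>f\<in>F. x w f * x w f) = real (card W)"
    using sum.cong[OF refl W2] by (simp add: sum.distrib sum_distrib_left)
  have "2 * (\<Sum>f\<in>F. \<Sum>w\<in>W. x w f * above w f) + (\<Sum>f\<in>F. \<Sum>w\<in>W. x w f * x w f) = real (card F)"
    using sum.cong[OF refl F2] by (simp add: sum.distrib sum_distrib_left)
  then have b: "2 * (\<Sum>w\<in>W. \<Sum>f\<in>F. x w f * above w f) + (\<Sum>w\<in>W. \<Sum>f\<in>F. x w f * x w f) = real (card W)"
    using card_eq sum.swap[of "\<lambda>f w. x w f * above w f" W F] sum.swap[of "\<lambda>f w. x w f * x w f" W F]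
    by simp
  have c: "(\<Sum>w\<in>W. \<Sum>f\<in>F. x w f) = real (card W)" by (simp add: row)
  \<comment> \<open>Half of \<open>a\<close> plus half of \<open>b\<close> shows that the first
    three sums add up to \<open>card W\<close>, which cancels the last sum.\<close>
  have "(\<Sum>w\<in>W. \<Sum>f\<in>F. g w f) = (\<Sum>w\<in>W. \<Sum>f\<in>F. x w f * lft w f) + (\<Sum>w\<in>W. \<Sum>f\<in>F. x w f * x w f)
     + (\<Sum>w\<in>W. \<Sum>f\<in>F. x w f * above w f) - (\<Sum>w\<in>W. \<Sum>f\<in>F. x w f)"
    by (simp add: g_def algebra_simps sum.distrib sum_subtractf)
  then have zero: "(\<Sum>w\<in>W. \<Sum>f\<in>F. g w f) = 0" using a b c by simp
  have nn: "0 \<le> g w f" if "w \<in> W" "f \<in> F" for w f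
    using above_ge[OF that] nonneg[OF that] by (simp add: g_def right_end_def)
  have "\<forall>w\<in>W. (\<Sum>f\<in>F. g w f) = 0"
    using zero sum_nonneg_eq_0_iff[OF finite_W, of "\<lambda>w. \<Sum>f\<in>F. g w f"] nn
    by (simp add: sum_nonneg)
  then have "\<forall>f\<in>F. g w f = 0"
    using w sum_nonneg_eq_0_iff[OF finite_F, of "g w"] nn[OF w] by simp
  then have "g w f = 0" using f by blast
  then show ?thesis using pos by (simp add: g_def right_end_def)
qed

section \<open>Order of the subintervals on either side of the market\<close>

lemma above_mono:
  assumes f: "f \<in> F" and ab: "a \<in> W" "b \<in> W" and pr: "fpref I f b a"
  shows "above b f + x b f \<le> above a f"
proof -
  have "above b f + x b f = sum (\<lambda>w. x w f) (insert b {w'\<in>W. fpref I f w' b})"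
    using finite_W f_order(1)[OF f ab(2)] by (simp add: above_def)
  also have "\<dots> \<le> above a f"
  proof -
    have "insert b {w'\<in>W. fpref I f w' b} \<subseteq> {w'\<in>W. fpref I f w' a}"
      using f_order(2)[OF f _ ab(2,1) _ pr] ab pr by auto
    then show ?thesis
      unfolding above_def using finite_W nonneg[OF _ f] by (intro sum_mono2) auto
  qed
  finally show ?thesis .
qed

lemma rgt_le_lft:
  assumes w: "w \<in> W" and fg: "f \<in> F" "g \<in> F" and pr: "wpref I w f g"
  shows "rgt w f \<le> lft w g"
proof -
  have "rgt w f = sum (x w) (insert f {f'\<in>F. wpref I w f' f})"
    using finite_F w_order(1)[OF w fg(1)] by (simp add: right_end_def left_end_def)
  also have "\<dots> \<le> lft w g"
  proof -
    have "insert f {f'\<in>F. wpref I w f' f} \<subseteq> {f'\<in>F. wpref I w f' g}"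
      using w_order(2)[OF w _ fg _ pr] fg pr by auto
    then show ?thesis
      unfolding left_end_def using finite_F nonneg[OF w] by (intro sum_mono2) auto
  qed
  finally show ?thesis .
qed

lemma ex_subinterval:
  assumes w: "w \<in> W" and \<theta>: "0 \<le> \<theta>" "\<theta> \<le> 1"
  shows "\<exists>f\<in>F. lft w f \<le> \<theta> \<and> \<theta> \<le> rgt w f"
proof -
  note R = is_instanceD(1)[OF inst w]
  have tr: "transp_on S (wpref I w)" and tot: "totalp_on S (wpref I w)" if "S \<subseteq> F" for S
    using R that unfolding strict_total_on_def by (auto intro: transp_on_subset totalp_on_subset)
  have as: "asymp_on S (wpref I w)" if "S \<subseteq> F" for S
    using w_order(4)[OF w] that by (intro asymp_onI) blast
  let ?S = "{f\<in>F. \<theta> \<le> rgt w f}"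
  \<comment> \<open>The subinterval of the least preferred firm \<open>g\<close> ends at 1, so some
    firm qualifies for \<open>?S\<close>.\<close>
  have "F \<noteq> {}" using w card_eq finite_W by auto
  then obtain g where g: "g \<in> F" "\<And>f. f \<in> F \<Longrightarrow> f \<noteq> g \<Longrightarrow> wpref I w f g"
    using Finite_Set.bex_greatest_element[OF finite_F] tr[of F] tot[of F] as[of F] by blast
  have "F = insert g {f'\<in>F. wpref I w f' g}" using g by auto
  then have "1 = sum (x w) (insert g {f'\<in>F. wpref I w f' g})" using row[OF w] by simp
  also have "\<dots> = rgt w g"
    using finite_F w_order(1)[OF w g(1)] by (simp add: right_end_def left_end_def)
  finally have "g \<in> ?S" using g \<theta> by simp
  \<comment> \<open>The most preferred firm whose subinterval does not end before \<theta>.\<close>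
  then obtain f where f: "f \<in> ?S" "\<And>h. h \<in> ?S \<Longrightarrow> h \<noteq> f \<Longrightarrow> wpref I w f h"
    using Finite_Set.bex_least_element[of ?S "wpref I w"] finite_F tr[of ?S] tot[of ?S] as[of ?S] by auto
  let ?U = "{f'\<in>F. wpref I w f' f}"
  have "lft w f \<le> \<theta>"
  proof (cases "?U = {}")
    case True
    then have "lft w f = 0" unfolding left_end_def by (simp only: sum.empty)
    then show ?thesis using \<theta> by simp
  next
    case False
    \<comment> \<open>The firm ranked directly above \<open>f\<close>: its right end is the left end
      of \<open>f\<close>, and by the choice of \<open>f\<close> it lies before \<theta>.\<close>
    then obtain h where h: "h \<in> ?U" "\<And>f'. f' \<in> ?U \<Longrightarrow> f' \<noteq> h \<Longrightarrow> wpref I w f' h"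
      using Finite_Set.bex_greatest_element[of ?U "wpref I w"] finite_F tr[of ?U] tot[of ?U] as[of ?U]
      by auto
    have hF: "h \<in> F" "wpref I w h f" and fF: "f \<in> F" using h(1) f(1) by auto
    have "wpref I w e f" if "e \<in> F" "wpref I w e h" for e
      using w_order(2)[OF w that(1) hF(1) fF that(2) hF(2)] .
    then have "?U = insert h {f'\<in>F. wpref I w f' h}" using h by blast
    then have "lft w f = sum (x w) (insert h {f'\<in>F. wpref I w f' h})"
      unfolding left_end_def by (rule arg_cong)
    also have "\<dots> = rgt w h"
      using finite_F w_order(1)[OF w hF(1)] by (simp add: right_end_def left_end_def)
    finally have "lft w f = rgt w h" .
    moreover have "\<not> \<theta> \<le> rgt w h"
    proof
      assume "\<theta> \<le> rgt w h"
      then have "h \<in> ?S" using hF by simp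
      moreover have "h \<noteq> f" using hF w_order(1)[OF w fF] by auto
      ultimately show False using f(2) w_order(4)[OF w hF(1) fF hF(2)] by blast
    qed
    ultimately show ?thesis by simp
  qed
  then show ?thesis using f by auto
qed

lemma rounding_stable:
  assumes \<theta>: "\<theta> \<in> {0..1}" and ne: "\<theta> \<notin> endpoints W F I x"
  shows "rounding W F I x \<theta> \<in> stable_matchings W F I"
proof -
  let ?m = "rounding W F I x \<theta>"
  \<comment> \<open>Strictness makes the chosen firm unique and forces positive mass on the chosen
    pair, so that \<open>above_eq\<close> applies to it.\<close>
  have strict: "lft w f < \<theta> \<and> \<theta> < rgt w f" if "w \<in> W" "f \<in> F" "\<theta> \<in> {lft w f..rgt w f}" for w f
    using that ne by (force simp: endpoints_def)
  have m: "?m w \<in> F \<and> lft w (?m w) < \<theta> \<and> \<theta> < rgt w (?m w)" if w: "w \<in> W" for w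
  proof -
    have "\<exists>!f. f \<in> F \<and> \<theta> \<in> {lft w f..rgt w f}"
    proof (rule ex_ex1I)
      show "\<exists>f. f \<in> F \<and> \<theta> \<in> {lft w f..rgt w f}" using ex_subinterval[OF w] \<theta> by auto
    next
      fix f g assume a: "f \<in> F \<and> \<theta> \<in> {lft w f..rgt w f}" "g \<in> F \<and> \<theta> \<in> {lft w g..rgt w g}"
      then have "lft w f < \<theta>" "\<theta> < rgt w f" "lft w g < \<theta>" "\<theta> < rgt w g"
        using strict[OF w] by blast+
      then show "f = g"
        using w_order(3)[OF w, of f g] a rgt_le_lft[OF w, of f g] rgt_le_lft[OF w, of g f] by force
    qed
    from theI'[OF this] show ?thesis
      using strict[OF w] w by (simp add: rounding_def)
  qed
  have mE: "?m \<in> W \<rightarrow>\<^sub>E F" using m by (auto simp: PiE_def rounding_def)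
  moreover have "?m a \<noteq> ?m b \<and> \<not> wpref I b (?m a) (?m b)"
    if ab: "a \<in> W" "b \<in> W" and pr: "fpref I (?m a) b a" for a b
  proof -
    let ?f = "?m a"
    have f: "?f \<in> F" and a: "\<theta> < rgt a ?f" "lft a ?f < \<theta>" using m[OF ab(1)] by auto
    have aa: "above a ?f = 1 - rgt a ?f"
      using above_eq[OF ab(1) f] a by (simp add: right_end_def)
    \<comment> \<open>Together with \<open>aa\<close> and \<open>ge\<close> this gives
      \<open>rgt a ?f \<le> lft b ?f\<close>. So \<theta> lies to the left of the subinterval of
      \<open>?f\<close> for \<open>b\<close>, who is therefore matched to a firm preferred to
      \<open>?f\<close>.\<close>
    have mono: "above b ?f + x b ?f \<le> above a ?f" by (rule above_mono[OF f ab pr])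
    have ge: "1 - rgt b ?f \<le> above b ?f" by (rule above_ge[OF ab(2) f])
    have nn: "0 \<le> x b ?f" by (rule nonneg[OF ab(2) f])
    have mb: "?m b \<in> F" "lft b (?m b) < \<theta>" using m[OF ab(2)] by auto
    have "?f \<noteq> ?m b"
    proof
      assume "?f = ?m b"
      then have "lft b ?f < \<theta>" using mb by simp
      then show False using aa mono ge a by (simp add: right_end_def)
    qed
    moreover have "\<not> wpref I b ?f (?m b)"
    proof
      assume "wpref I b ?f (?m b)"
      then have "rgt b ?f < \<theta>" using rgt_le_lft[OF ab(2) f mb(1)] mb by simp
      then show False using aa mono ge a nn by simp
    qed
    ultimately show ?thesis by blast
  qed
  ultimately show ?thesis by (simp add: stable_iff)
qed

end

context one_worker
begin

lemma feasible_fractional_stable: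
  assumes "feasible W F k A x" "i < k"
  shows "fractional_stable W F (A i) x"
  using matching_instance[OF assms(2)] assms
  unfolding fractional_stable_def fractional_stable_axioms_def feasible_def by auto

lemma rounding_coincides:
  assumes x: "feasible W F k A x" and \<theta>: "\<theta> \<in> {0..1}"
    and ne: "\<And>i. i < k \<Longrightarrow> \<theta> \<notin> endpoints W F (A i) x" and ij: "i < k" "j < k"
  shows "rounding W F (A i) x \<theta> = rounding W F (A j) x \<theta>"
proof (rule perfect_matching_eqI[where ?w0.0 = w0])
  show "perfect_matching W F (rounding W F (A i) x \<theta>)" "perfect_matching W F (rounding W F (A j) x \<theta>)"
    using fractional_stable.rounding_stable[OF feasible_fractional_stable[OF x ij(1)] \<theta> ne[OF ij(1)]]
      fractional_stable.rounding_stable[OF feasible_fractional_stable[OF x ij(2)] \<theta> ne[OF ij(2)]]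
    by (auto intro: stable_matchings_perfect)
next
  fix w assume w: "w \<in> W" "w \<noteq> w0"
  have eq: "left_end F (A i) x w f = left_end F (A j) x w f" if "f \<in> F" for f
    unfolding left_end_def using common[OF w ij _ that] by (intro sum.cong) auto
  have "(\<lambda>f. f \<in> F \<and> \<theta> \<in> {left_end F (A i) x w f..right_end F (A i) x w f}) =
        (\<lambda>f. f \<in> F \<and> \<theta> \<in> {left_end F (A j) x w f..right_end F (A j) x w f})"
    using eq by (auto simp: right_end_def)
  then show "rounding W F (A i) x \<theta> w = rounding W F (A j) x \<theta> w"
    using w by (simp add: rounding_def)
qed

lemma rounding_common_stable:
  assumes x: "feasible W F k A x" and \<theta>: "\<theta> \<in> {0..1}"
    and ne: "\<And>i. i < k \<Longrightarrow> \<theta> \<notin> endpoints W F (A i) x" and i: "i < k"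
  shows "rounding W F (A i) x \<theta> \<in> common_stable W F k A"
proof -
  have "rounding W F (A i) x \<theta> \<in> stable_matchings W F (A j)" if "j < k" for j
    using rounding_coincides[OF assms that]
      fractional_stable.rounding_stable[OF feasible_fractional_stable[OF x that] \<theta> ne[OF that]]
    by simp
  then show ?thesis by (auto simp: common_stable_def)
qed

end

section \<open>Running time of structured programs\<close>

fun writes :: "prog \<Rightarrow> string set" where
  "writes Skip = {}"
| "writes (Assign v es e) = {v}"
| "writes (Seq p q) = writes p \<union> writes q"
| "writes (If e p q) = writes p \<union> writes q"
| "writes (While e p) = writes p"

lemma exec_frame: "exec p s t s' \<Longrightarrow> v \<notin> writes p \<Longrightarrow> s' v = s v"
  by (induction rule: exec.induct) auto

abbreviation Var :: "string \<Rightarrow> expr" where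
  "Var v \<equiv> Cell v []"

text \<open>Truncated subtraction is nonzero exactly while the counter is below the bound.\<close>

definition for_test :: "string \<Rightarrow> string \<Rightarrow> expr" where
  "for_test v u = Sub (Var u) (Var v)"

definition for_body :: "string \<Rightarrow> prog \<Rightarrow> prog" where
  "for_body v p = Seq p (Assign v [] (Add (Var v) (Const 1)))"

definition For :: "string \<Rightarrow> string \<Rightarrow> prog \<Rightarrow> prog" where
  "For v u p = Seq (Assign v [] (Const 0)) (While (for_test v u) (for_body v p))"

lemma writes_For [simp]: "writes (For v u p) = insert v (writes p)"
  by (auto simp: For_def for_body_def)

text \<open>Programs are described by their effect on an abstraction \<open>\<alpha>\<close> of the store, which reads only
  the variables in \<open>X\<close>. The variables in \<open>D\<close> keep their initial contents \<open>\<rho>\<close>, and an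
  environment \<open>E\<close> records the values of the enclosing loop counters. Times are bounded by
  monomials in \<open>m\<close>.\<close>

locale program_analysis =
  fixes \<rho> :: store and D :: "string set" and \<alpha> :: "store \<Rightarrow> 'a" and X :: "string set" and m :: nat
  assumes abs_cong: "\<And>s s'. (\<And>v. v \<in> X \<Longrightarrow> s v = s' v) \<Longrightarrow> \<alpha> s = \<alpha> s'"
    and m_pos: "1 \<le> m"
begin

definition agrees :: "(string \<rightharpoonup> nat) \<Rightarrow> store \<Rightarrow> bool" where
  "agrees E s \<longleftrightarrow> (\<forall>v\<in>D. s v = \<rho> v) \<and> (\<forall>v x. E v = Some x \<longrightarrow> s v [] = x)"

text \<open>Preservation of \<open>D\<close> and of the enclosing counters is a syntactic condition
  on \<open>writes\<close>, made semantic by \<open>exec_frame\<close>; \<phi> therefore only has to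
  describe the abstraction.\<close>

definition computes :: "(string \<rightharpoonup> nat) \<Rightarrow> prog \<Rightarrow> ('a \<Rightarrow> 'a) \<Rightarrow> nat \<Rightarrow> nat \<Rightarrow> bool" where
  "computes E p \<phi> c d \<longleftrightarrow> writes p \<inter> (D \<union> dom E) = {} \<and>
     (\<forall>s. agrees E s \<longrightarrow> (\<exists>t s'. exec p s t s' \<and> t \<le> c * m ^ d \<and> \<alpha> s' = \<phi> (\<alpha> s)))"

section \<open>Timed rules for the program constructs\<close>

lemma computesD:
  assumes "computes E p \<phi> c d" "agrees E s"
  obtains t s' where "exec p s t s'" "t \<le> c * m ^ d" "\<alpha> s' = \<phi> (\<alpha> s)" "agrees E s'"
proof -
  from assms obtain t s' where *: "exec p s t s'" "t \<le> c * m ^ d" "\<alpha> s' = \<phi> (\<alpha> s)"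
    unfolding computes_def by blast
  have "writes p \<inter> (D \<union> dom E) = {}" using assms by (simp add: computes_def)
  then have "s' v = s v" if "v \<in> D \<union> dom E" for v
    using exec_frame[OF *(1)] that by blast
  then have "agrees E s'" using assms(2) unfolding agrees_def by (metis UnI1 UnI2 domI)
  with * show thesis by (rule that)
qed

lemma monomial_mono:
  assumes "c \<le> c'" "d \<le> d'" shows "c * m ^ d \<le> c' * m ^ d'"
  using assms m_pos by (intro mult_mono power_increasing) auto

lemma computes_mono:
  assumes "computes E p \<phi> c d" "c \<le> c'" "d \<le> d'"
  shows "computes E p \<phi> c' d'"
  using assms monomial_mono[OF assms(2,3)] unfolding computes_def by (meson order_trans)

lemma computes_Skip: "computes E Skip (\<lambda>x. x) 1 0"
  unfolding computes_def by (auto intro!: exI exec_Skip)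

lemma computes_Assign:
  assumes "v \<notin> D" "v \<notin> dom E"
    and "\<And>s. agrees E s \<Longrightarrow> \<alpha> (s(v := (s v)(map (\<lambda>a. eval a s) es := eval e s))) = \<phi> (\<alpha> s)"
  shows "computes E (Assign v es e) \<phi> (1 + sum_list (map expr_cost es) + expr_cost e) 0"
  unfolding computes_def
proof (intro conjI allI impI)
  fix s assume "agrees E s"
  then show "\<exists>t s'. exec (Assign v es e) s t s' \<and>
      t \<le> (1 + sum_list (map expr_cost es) + expr_cost e) * m ^ 0 \<and> \<alpha> s' = \<phi> (\<alpha> s)"
    using assms(3) exec_Assign[of v es e s] by (intro exI conjI) auto
qed (use assms in auto)

lemma computes_Seq:
  assumes p: "computes E p \<phi> c d" and q: "computes E q \<psi> c' d'"
  shows "computes E (Seq p q) (\<lambda>x. \<psi> (\<phi> x)) (1 + c + c') (max d d')"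
  unfolding computes_def
proof (intro conjI allI impI)
  show "writes (Seq p q) \<inter> (D \<union> dom E) = {}" using p q by (auto simp: computes_def)
next
  fix s assume s: "agrees E s"
  obtain t s1 where 1: "exec p s t s1" "t \<le> c * m ^ d" "\<alpha> s1 = \<phi> (\<alpha> s)" "agrees E s1"
    using computesD[OF p s] .
  obtain u s2 where 2: "exec q s1 u s2" "u \<le> c' * m ^ d'" "\<alpha> s2 = \<psi> (\<alpha> s1)"
    using computesD[OF q 1(4)] .
  have "c * m ^ d \<le> c * m ^ max d d'" "c' * m ^ d' \<le> c' * m ^ max d d'" "1 \<le> m ^ max d d'"
    using monomial_mono[of c c] monomial_mono[of c' c'] m_pos by auto
  then have "1 + t + u \<le> (1 + c + c') * m ^ max d d'"
    using 1 2 unfolding add_mult_distrib by linarith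
  then show "\<exists>t s'. exec (Seq p q) s t s' \<and> t \<le> (1 + c + c') * m ^ max d d' \<and> \<alpha> s' = \<psi> (\<phi> (\<alpha> s))"
    using exec_Seq[OF 1(1) 2(1)] 1 2 by auto
qed

lemma computes_If:
  assumes b: "\<And>s. agrees E s \<Longrightarrow> eval b s \<noteq> 0 \<longleftrightarrow> B (\<alpha> s)"
    and p: "computes E p \<phi> c d" and q: "computes E q \<psi> c' d'"
  shows "computes E (If b p q) (\<lambda>x. if B x then \<phi> x else \<psi> x) (1 + expr_cost b + c + c') (max d d')"
  unfolding computes_def
proof (intro conjI allI impI)
  show "writes (If b p q) \<inter> (D \<union> dom E) = {}" using p q by (auto simp: computes_def)
next
  fix s assume s: "agrees E s"
  let ?T = "(1 + expr_cost b + c + c') * m ^ max d d'"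
  have mon: "c * m ^ d \<le> c * m ^ max d d'" "c' * m ^ d' \<le> c' * m ^ max d d'"
    "1 + expr_cost b \<le> (1 + expr_cost b) * m ^ max d d'"
    using monomial_mono[of c c d "max d d'"] monomial_mono[of c' c' d' "max d d'"]
      monomial_mono[of "1 + expr_cost b" "1 + expr_cost b" 0 "max d d'"] by auto
  show "\<exists>t s'. exec (If b p q) s t s' \<and> t \<le> ?T \<and> \<alpha> s' = (if B (\<alpha> s) then \<phi> (\<alpha> s) else \<psi> (\<alpha> s))"
  proof (cases "eval b s = 0")
    case False
    obtain t s1 where 1: "exec p s t s1" "t \<le> c * m ^ d" "\<alpha> s1 = \<phi> (\<alpha> s)"
      using computesD[OF p s] .
    have "1 + expr_cost b + t \<le> ?T"
      using 1 mon unfolding add_mult_distrib by linarith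
    then show ?thesis using exec_IfTrue[OF False 1(1)] 1 b[OF s] False by auto
  next
    case True
    obtain t s1 where 1: "exec q s t s1" "t \<le> c' * m ^ d'" "\<alpha> s1 = \<psi> (\<alpha> s)"
      using computesD[OF q s] .
    have "1 + expr_cost b + t \<le> ?T"
      using 1 mon unfolding add_mult_distrib by linarith
    then show ?thesis using exec_IfFalse[OF True 1(1)] 1 b[OF s] True by auto
  qed
qed

text \<open>Induction on the number of remaining rounds. Besides its body, a round costs 4 for the
  test and 5 for \<open>Seq\<close> and the increment; the final failing test costs 4.\<close>

lemma for_loop:
  assumes v: "v \<notin> X" "v \<notin> D" "v \<notin> dom E" and u: "u \<in> D" "\<rho> u [] = N"
    and body: "\<And>j. j < N \<Longrightarrow> computes (E(v \<mapsto> j)) p (\<phi> j) c d"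
    and s: "agrees (E(v \<mapsto> j)) s" "j \<le> N"
  shows "\<exists>t s'. exec (While (for_test v u) (for_body v p)) s t s' \<and>
    t \<le> (N - j) * (c * m ^ d + 9) + 4 \<and> \<alpha> s' = fold \<phi> [j..<N] (\<alpha> s)"
  using s
proof (induction "N - j" arbitrary: j s)
  case 0
  then have "eval (for_test v u) s = 0" using u by (auto simp: agrees_def for_test_def)
  from exec_WhileFalse[OF this, of "for_body v p"] show ?case
    using 0 by (intro exI conjI) (auto simp: for_test_def)
next
  case (Suc l)
  then have j: "j < N" by simp
  have test: "eval (for_test v u) s \<noteq> 0" using Suc.prems u j by (auto simp: agrees_def for_test_def)
  obtain t s1 where 1: "exec p s t s1" "t \<le> c * m ^ d" "\<alpha> s1 = \<phi> j (\<alpha> s)" "agrees (E(v \<mapsto> j)) s1"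
    using computesD[OF body[OF j] Suc.prems(1)] .
  let ?s2 = "s1(v := (s1 v)([] := Suc j))"
  have "exec (Assign v [] (Add (Var v) (Const 1))) s1 4 ?s2"
    using exec_Assign[of v "[]" "Add (Var v) (Const 1)" s1] 1(4)
    by (simp add: agrees_def eval_nat_numeral)
  from exec_Seq[OF 1(1) this] have b: "exec (for_body v p) s (t + 5) ?s2"
    by (simp add: for_body_def eval_nat_numeral)
  have "agrees (E(v \<mapsto> Suc j)) ?s2" using 1(4) v unfolding agrees_def
    by (auto simp: domIff split: if_splits)
  moreover have "l = N - Suc j" using Suc.hyps(2) by simp
  ultimately obtain t' s3 where 3: "exec (While (for_test v u) (for_body v p)) ?s2 t' s3"
      "t' \<le> (N - Suc j) * (c * m ^ d + 9) + 4" "\<alpha> s3 = fold \<phi> [Suc j..<N] (\<alpha> ?s2)"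
    using Suc.hyps(1)[of "Suc j" ?s2] j by auto
  \<comment> \<open>The counter lies outside \<open>X\<close>, so incrementing it is invisible to
    the abstraction.\<close>
  have "\<alpha> ?s2 = \<alpha> s1" using v by (intro abs_cong) auto
  then have "\<alpha> s3 = fold \<phi> [j..<N] (\<alpha> s)" using 3 1 j by (simp add: upt_rec[of j])
  moreover have "N - j = Suc (N - Suc j)" using j by simp
  then have "1 + expr_cost (for_test v u) + (t + 5) + t' \<le> (N - j) * (c * m ^ d + 9) + 4"
    using 1(2) 3(2) by (simp add: for_test_def)
  ultimately show ?case using exec_WhileTrue[OF test b 3(1)] by blast
qed

lemma computes_For:
  assumes v: "v \<notin> X" "v \<notin> D" "v \<notin> dom E" and u: "u \<in> D" "\<rho> u [] = N" "0 < N" "N \<le> m"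
    and body: "\<And>j. j < N \<Longrightarrow> computes (E(v \<mapsto> j)) p (\<phi> j) c d"
  shows "computes E (For v u p) (fold \<phi> [0..<N]) (c + 16) (Suc d)"
  unfolding computes_def
proof (intro conjI allI impI)
  \<comment> \<open>The condition on \<open>writes p\<close> is available only through an instance
    of \<open>body\<close>, and \<open>0 < N\<close> provides one.\<close>
  have "writes p \<inter> (D \<union> dom (E(v \<mapsto> 0))) = {}" using body[OF u(3)] by (simp only: computes_def)
  then show "writes (For v u p) \<inter> (D \<union> dom E) = {}" using v by auto
next
  fix s assume s: "agrees E s"
  let ?s1 = "s(v := (s v)([] := 0))"
  have a: "exec (Assign v [] (Const 0)) s 2 ?s1"
    using exec_Assign[of v "[]" "Const 0" s] by (simp add: eval_nat_numeral)
  have "agrees (E(v \<mapsto> 0)) ?s1" using s v unfolding agrees_def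
    by (auto simp: domIff split: if_splits)
  from for_loop[OF v u(1,2) body this]
  obtain t s' where 1: "exec (While (for_test v u) (for_body v p)) ?s1 t s'"
      "t \<le> N * (c * m ^ d + 9) + 4" "\<alpha> s' = fold \<phi> [0..<N] (\<alpha> ?s1)" by auto
  have "\<alpha> ?s1 = \<alpha> s" using v by (intro abs_cong) auto
  moreover have "1 + 2 + t \<le> (c + 16) * m ^ Suc d"
  proof -
    \<comment> \<open>The constant 16 is the 9 of each round plus 7 paid once: 1 for
      \<open>Seq\<close>, 2 for the initialisation and 4 for the last test.\<close>
    have "N * (c * m ^ d + 9) \<le> m * (c * m ^ d + 9)" using u by (intro mult_right_mono) auto
    also have "\<dots> = c * m ^ Suc d + 9 * m" by (simp add: algebra_simps)
    finally have "1 + 2 + t \<le> c * m ^ Suc d + 9 * m + 7" using 1(2) by linarith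
    moreover have "m \<le> m ^ Suc d" "1 \<le> m ^ Suc d" using m_pos by auto
    then have "9 * m + 7 \<le> 16 * m ^ Suc d" by linarith
    ultimately show ?thesis unfolding add_mult_distrib by linarith
  qed
  ultimately show "\<exists>t s'. exec (For v u p) s t s' \<and> t \<le> (c + 16) * m ^ Suc d \<and>
      \<alpha> s' = fold \<phi> [0..<N] (\<alpha> s)"
    using exec_Seq[OF a 1(1)] 1(3) unfolding For_def by auto
qed

end

section \<open>The search program\<close>

text \<open>At most one of the two truncated differences is nonzero, and both vanish only for equal
  values.\<close>

definition neq_test :: "expr \<Rightarrow> expr \<Rightarrow> expr" where
  "neq_test e e' = Add (Sub e e') (Sub e' e)"

lemma eval_neq_test [simp]: "eval (neq_test e e') s = 0 \<longleftrightarrow> eval e s = eval e' s"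
  by (auto simp: neq_test_def)

text \<open>A conjunction is coded as a sum of naturals, which vanishes iff every summand does, and
  \<open>\<le>\<close> as a vanishing difference. The test thus succeeds when there is no violation,
  which is why \<open>Skip\<close> is its first branch in \<open>step_prog\<close>.\<close>

definition violation_test :: expr where
  "violation_test =
     Add (neq_test (Cell ''p'' [Var ''a'']) (Cell ''wrank'' [Const 0, Var ''a'', Var ''f'']))
    (Add (neq_test (Cell ''p'' [Var ''b'']) (Cell ''wrank'' [Const 0, Var ''b'', Var ''g'']))
    (Add (Sub (Add (Cell ''frank'' [Var ''i'', Var ''f'', Var ''b'']) (Const 1))
              (Cell ''frank'' [Var ''i'', Var ''f'', Var ''a'']))
         (Sub (Cell ''wrank'' [Var ''i'', Var ''b'', Var ''f''])
              (Cell ''wrank'' [Var ''i'', Var ''b'', Var ''g'']))))"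

definition step_prog :: prog where
  "step_prog = If violation_test Skip
     (Seq (Assign ''ok'' [] (Const 0))
          (If (neq_test (Var ''a'') (Var ''v''))
             (Assign ''p'' [Var ''a''] (Add (Cell ''p'' [Var ''a'']) (Const 1))) Skip))"

definition overflow_prog :: prog where
  "overflow_prog = If (Sub (Var ''n'') (Cell ''p'' [Var ''w''])) Skip (Assign ''ok'' [] (Const 0))"

definition round_prog :: prog where
  "round_prog = Seq (Assign ''ok'' [] (Const 1))
     (Seq (For ''a'' ''n'' (For ''f'' ''n'' (For ''b'' ''n'' (For ''g'' ''n''
             (For ''i'' ''k'' step_prog)))))
          (For ''w'' ''n'' overflow_prog))"

text \<open>The pointer of \<open>v\<close> is set last, so that \<open>r\<close> prevails over
  \<open>q\<close> if \<open>u = v\<close>.\<close>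

definition start_prog :: prog where
  "start_prog = Seq (For ''w'' ''n'' (Assign ''p'' [Var ''w''] (Const 0)))
     (Seq (Assign ''p'' [Var ''u''] (Var ''q'')) (Assign ''p'' [Var ''v''] (Var ''r'')))"

definition update_prog :: prog where
  "update_prog = Seq
     (If (Sub (Cell ''best'' [Var ''w'']) (Cell ''p'' [Var ''w'']))
        (Assign ''best'' [Var ''w''] (Cell ''p'' [Var ''w''])) Skip)
     (If (Sub (Cell ''p'' [Var ''w'']) (Cell ''worst'' [Var ''w'']))
        (Assign ''worst'' [Var ''w''] (Cell ''p'' [Var ''w''])) Skip)"

text \<open>The counters \<open>j\<close> and \<open>l\<close> merely repeat the round
  \<open>n * n\<close> times, more than the largest possible sum of \<open>n\<close> ranks.\<close>

definition trial_prog :: prog where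
  "trial_prog = Seq start_prog (Seq (For ''j'' ''n'' (For ''l'' ''n'' round_prog))
     (If (Var ''ok'') (Seq (Assign ''found'' [] (Const 1)) (For ''w'' ''n'' update_prog)) Skip))"

definition output_prog :: prog where
  "output_prog = Seq
     (If (neq_test (Cell ''best'' [Var ''w'']) (Cell ''wrank'' [Const 0, Var ''w'', Var ''f'']))
        Skip (Assign ''wopt'' [Var ''w''] (Var ''f'')))
     (If (neq_test (Cell ''worst'' [Var ''w'']) (Cell ''wrank'' [Const 0, Var ''w'', Var ''f'']))
        Skip (Assign ''fopt'' [Var ''w''] (Var ''f'')))"

text \<open>The exceptional worker is not part of the input, so it is guessed as well.
  \<open>best\<close> starts above every rank, whereas \<open>worst\<close> relies on memory being
  initially 0, the neutral value for the maximum.\<close>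

definition search_prog :: prog where
  "search_prog = Seq (For ''w'' ''n'' (Assign ''best'' [Var ''w''] (Var ''n'')))
     (Seq (For ''v'' ''n'' (For ''r'' ''n'' (For ''u'' ''n'' (For ''q'' ''n'' trial_prog))))
          (For ''w'' ''n'' (For ''f'' ''n'' output_prog)))"

record search_state =
  ptr :: "nat \<Rightarrow> nat"
  ok :: nat
  found :: nat
  best :: "nat \<Rightarrow> nat"
  worst :: "nat \<Rightarrow> nat"
  wopt :: "nat \<Rightarrow> nat"
  fopt :: "nat \<Rightarrow> nat"

definition search_abs :: "store \<Rightarrow> search_state" where
  "search_abs s = \<lparr>ptr = \<lambda>w. s ''p'' [w], ok = s ''ok'' [], found = s ''found'' [],
     best = \<lambda>w. s ''best'' [w], worst = \<lambda>w. s ''worst'' [w],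
     wopt = \<lambda>w. s ''wopt'' [w], fopt = \<lambda>w. s ''fopt'' [w]\<rparr>"

locale common_search =
  fixes n k :: nat and A :: "nat \<Rightarrow> (nat, nat) sm_instance"
  assumes n_pos: "0 < n" and k_pos: "0 < k"
begin

section \<open>The search as a function on abstract states\<close>

definition wrk :: "nat \<Rightarrow> nat \<Rightarrow> nat \<Rightarrow> nat" where
  "wrk i w f = input n k A ''wrank'' [i, w, f]"

definition frk :: "nat \<Rightarrow> nat \<Rightarrow> nat \<Rightarrow> nat" where
  "frk i f w = input n k A ''frank'' [i, f, w]"

text \<open>If every worker \<open>w\<close> were matched to the firm of rank \<open>p w\<close> in her list in \<open>A 0\<close>, then
  either \<open>a\<close> and \<open>b\<close> would share the firm \<open>f = g\<close>, or \<open>(b, f)\<close> would block in \<open>A i\<close>, where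
  \<open>f\<close> is the partner of \<open>a\<close> and \<open>g\<close> that of \<open>b\<close>.\<close>

definition violation :: "(nat \<Rightarrow> nat) \<Rightarrow> nat \<Rightarrow> nat \<Rightarrow> nat \<Rightarrow> nat \<Rightarrow> nat \<Rightarrow> bool" where
  "violation p a f b g i \<longleftrightarrow> p a = wrk 0 a f \<and> p b = wrk 0 b g \<and> frk i f b < frk i f a \<and>
     wrk i b f \<le> wrk i b g"

definition step :: "nat \<Rightarrow> nat \<Rightarrow> nat \<Rightarrow> nat \<Rightarrow> nat \<Rightarrow> nat \<Rightarrow> search_state \<Rightarrow> search_state" where
  "step v a f b g i x = (if \<not> violation (ptr x) a f b g i then x else
     if a \<noteq> v then x\<lparr>ok := 0, ptr := (ptr x)(a := ptr x a + 1)\<rparr> else x\<lparr>ok := 0\<rparr>)"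

definition overflow :: "nat \<Rightarrow> search_state \<Rightarrow> search_state" where
  "overflow w x = (if ptr x w < n then x else x\<lparr>ok := 0\<rparr>)"

definition sweep :: "nat \<Rightarrow> search_state \<Rightarrow> search_state" where
  "sweep v = fold (\<lambda>a. fold (\<lambda>f. fold (\<lambda>b. fold (\<lambda>g. fold (\<lambda>i. step v a f b g i) [0..<k])
     [0..<n]) [0..<n]) [0..<n]) [0..<n]"

definition run_round :: "nat \<Rightarrow> search_state \<Rightarrow> search_state" where
  "run_round v x = fold overflow [0..<n] (sweep v (x\<lparr>ok := 1\<rparr>))"

definition start :: "nat \<Rightarrow> nat \<Rightarrow> nat \<Rightarrow> nat \<Rightarrow> search_state \<Rightarrow> search_state" where
  "start v r u q x =
     (let y = fold (\<lambda>w x. x\<lparr>ptr := (ptr x)(w := 0)\<rparr>) [0..<n] x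
      in y\<lparr>ptr := (ptr y)(u := q, v := r)\<rparr>)"

definition update :: "nat \<Rightarrow> search_state \<Rightarrow> search_state" where
  "update w x = x\<lparr>best := (best x)(w := min (best x w) (ptr x w)),
     worst := (worst x)(w := max (worst x w) (ptr x w))\<rparr>"

definition trial :: "nat \<Rightarrow> nat \<Rightarrow> nat \<Rightarrow> nat \<Rightarrow> search_state \<Rightarrow> search_state" where
  "trial v r u q x =
     (let y = fold (\<lambda>_. fold (\<lambda>_. run_round v) [0..<n]) [0..<n] (start v r u q x)
      in if ok y \<noteq> 0 then fold update [0..<n] (y\<lparr>found := 1\<rparr>) else y)"

definition emit :: "nat \<Rightarrow> nat \<Rightarrow> search_state \<Rightarrow> search_state" where
  "emit w f x = x\<lparr>wopt := (if best x w = wrk 0 w f then (wopt x)(w := f) else wopt x),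
     fopt := (if worst x w = wrk 0 w f then (fopt x)(w := f) else fopt x)\<rparr>"

definition trials :: "search_state \<Rightarrow> search_state" where
  "trials = fold (\<lambda>v. fold (\<lambda>r. fold (\<lambda>u. fold (\<lambda>q. trial v r u q) [0..<n]) [0..<n]) [0..<n]) [0..<n]"

definition run_search :: "search_state \<Rightarrow> search_state" where
  "run_search x = fold (\<lambda>w. fold (\<lambda>f. emit w f) [0..<n]) [0..<n]
     (trials (fold (\<lambda>w x. x\<lparr>best := (best x)(w := n)\<rparr>) [0..<n] x))"

sublocale program_analysis "input n k A" "{''n'', ''k'', ''wrank'', ''frank''}" search_abs
  "{''p'', ''ok'', ''found'', ''best'', ''worst'', ''wopt'', ''fopt''}" "n + k"
  using n_pos by unfold_locales (auto simp: search_abs_def)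

section \<open>Effect and cost of the subprograms\<close>

lemma agreesD:
  assumes "agrees E s"
  shows "s ''n'' [] = n" "s ''k'' [] = k" "s ''wrank'' [i, w, f] = wrk i w f"
    "s ''frank'' [i, f, w] = frk i f w" "E v = Some x \<Longrightarrow> s v [] = x"
  using assms by (auto simp: agrees_def wrk_def frk_def input_def)

lemma computes_For_n:
  assumes "v \<notin> {''n'', ''k'', ''wrank'', ''frank'', ''p'', ''ok'', ''found'', ''best'', ''worst'', ''wopt'', ''fopt''}"
    "v \<notin> dom E" "\<And>j. j < n \<Longrightarrow> computes (E(v \<mapsto> j)) p (\<phi> j) c d"
  shows "computes E (For v ''n'' p) (fold \<phi> [0..<n]) (c + 16) (Suc d)"
  using assms n_pos by (intro computes_For) (auto simp: input_def)

lemma computes_For_k: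
  assumes "v \<notin> {''n'', ''k'', ''wrank'', ''frank'', ''p'', ''ok'', ''found'', ''best'', ''worst'', ''wopt'', ''fopt''}"
    "v \<notin> dom E" "\<And>j. j < k \<Longrightarrow> computes (E(v \<mapsto> j)) p (\<phi> j) c d"
  shows "computes E (For v ''k'' p) (fold \<phi> [0..<k]) (c + 16) (Suc d)"
  using assms k_pos by (intro computes_For) (auto simp: input_def)

lemma computes_cong:
  assumes "computes E p \<phi> c d" "\<And>x. \<phi> x = \<psi> x" "c \<le> c'" "d \<le> d'"
  shows "computes E p \<psi> c' d'"
proof -
  have "\<phi> = \<psi>" by (rule ext) (rule assms(2))
  then show ?thesis using computes_mono[OF assms(1,3,4)] by simp
qed

lemma computes_ok:
  "''ok'' \<notin> dom E \<Longrightarrow> computes E (Assign ''ok'' [] (Const c)) (\<lambda>x. x\<lparr>ok := c\<rparr>) 2 0"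
  using computes_Assign[of "''ok''" E "[]" "Const c" "\<lambda>x. x\<lparr>ok := c\<rparr>"]
  by (auto simp: search_abs_def eval_nat_numeral)

lemma computes_found:
  "''found'' \<notin> dom E \<Longrightarrow> computes E (Assign ''found'' [] (Const c)) (\<lambda>x. x\<lparr>found := c\<rparr>) 2 0"
  using computes_Assign[of "''found''" E "[]" "Const c" "\<lambda>x. x\<lparr>found := c\<rparr>"]
  by (auto simp: search_abs_def eval_nat_numeral)

lemma computes_array:
  assumes E: "E w = Some a" and e: "\<And>s. agrees E s \<Longrightarrow> eval e s = \<psi> (search_abs s)"
    and dom: "v \<notin> dom E"
  shows "v = ''p'' \<Longrightarrow> computes E (Assign v [Var w] e) (\<lambda>x. x\<lparr>ptr := (ptr x)(a := \<psi> x)\<rparr>) (2 + expr_cost e) 0"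
    and "v = ''best'' \<Longrightarrow> computes E (Assign v [Var w] e) (\<lambda>x. x\<lparr>best := (best x)(a := \<psi> x)\<rparr>) (2 + expr_cost e) 0"
    and "v = ''worst'' \<Longrightarrow> computes E (Assign v [Var w] e) (\<lambda>x. x\<lparr>worst := (worst x)(a := \<psi> x)\<rparr>) (2 + expr_cost e) 0"
    and "v = ''wopt'' \<Longrightarrow> computes E (Assign v [Var w] e) (\<lambda>x. x\<lparr>wopt := (wopt x)(a := \<psi> x)\<rparr>) (2 + expr_cost e) 0"
    and "v = ''fopt'' \<Longrightarrow> computes E (Assign v [Var w] e) (\<lambda>x. x\<lparr>fopt := (fopt x)(a := \<psi> x)\<rparr>) (2 + expr_cost e) 0"
proof -
  have gen: "computes E (Assign v [Var w] e) \<phi> (2 + expr_cost e) 0"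
    if "v \<notin> {''n'', ''k'', ''wrank'', ''frank''}"
      "\<And>s. agrees E s \<Longrightarrow> search_abs (s(v := (s v)([a] := eval e s))) = \<phi> (search_abs s)" for \<phi>
  proof -
    have "computes E (Assign v [Var w] e) \<phi> (1 + sum_list (map expr_cost [Var w]) + expr_cost e) 0"
    proof (rule computes_Assign)
      fix s assume s: "agrees E s"
      then have "map (\<lambda>e. eval e s) [Var w] = [a]" using E by (simp add: agreesD(5)[OF s])
      then show "search_abs (s(v := (s v)(map (\<lambda>e. eval e s) [Var w] := eval e s))) = \<phi> (search_abs s)"
        using that(2)[OF s] by simp
    qed (use that dom in auto)
    then show ?thesis by (simp add: eval_nat_numeral)
  qed
  show "v = ''p'' \<Longrightarrow> computes E (Assign v [Var w] e) (\<lambda>x. x\<lparr>ptr := (ptr x)(a := \<psi> x)\<rparr>) (2 + expr_cost e) 0"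
    "v = ''best'' \<Longrightarrow> computes E (Assign v [Var w] e) (\<lambda>x. x\<lparr>best := (best x)(a := \<psi> x)\<rparr>) (2 + expr_cost e) 0"
    "v = ''worst'' \<Longrightarrow> computes E (Assign v [Var w] e) (\<lambda>x. x\<lparr>worst := (worst x)(a := \<psi> x)\<rparr>) (2 + expr_cost e) 0"
    "v = ''wopt'' \<Longrightarrow> computes E (Assign v [Var w] e) (\<lambda>x. x\<lparr>wopt := (wopt x)(a := \<psi> x)\<rparr>) (2 + expr_cost e) 0"
    "v = ''fopt'' \<Longrightarrow> computes E (Assign v [Var w] e) (\<lambda>x. x\<lparr>fopt := (fopt x)(a := \<psi> x)\<rparr>) (2 + expr_cost e) 0"
    by (rule gen; simp add: e; auto simp: search_abs_def fun_eq_iff)+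
qed

lemma computes_step:
  assumes E: "E ''a'' = Some a" "E ''f'' = Some f" "E ''b'' = Some b" "E ''g'' = Some g"
    "E ''i'' = Some i" "E ''v'' = Some v" and dom: "''p'' \<notin> dom E" "''ok'' \<notin> dom E"
  shows "computes E step_prog (step v a f b g i) 100 0"
proof -
  have t1: "eval violation_test s \<noteq> 0 \<longleftrightarrow> \<not> violation (ptr (search_abs s)) a f b g i"
    if s: "agrees E s" for s
    using agreesD(5)[OF s] E
    by (auto simp: violation_test_def violation_def search_abs_def agreesD(3,4)[OF s] neq_test_def)
  have t2: "eval (neq_test (Var ''a'') (Var ''v'')) s \<noteq> 0 \<longleftrightarrow> a \<noteq> v" if s: "agrees E s" for s
    using agreesD(5)[OF s] E by simp
  have p: "computes E (Assign ''p'' [Var ''a''] (Add (Cell ''p'' [Var ''a'']) (Const 1)))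
      (\<lambda>x. x\<lparr>ptr := (ptr x)(a := ptr x a + 1)\<rparr>)
      (2 + expr_cost (Add (Cell ''p'' [Var ''a'']) (Const 1))) 0"
  proof (rule computes_array(1))
    fix s assume s: "agrees E s"
    show "eval (Add (Cell ''p'' [Var ''a'']) (Const 1)) s = ptr (search_abs s) a + 1"
      using agreesD(5)[OF s] E by (simp add: search_abs_def)
  qed (use E dom in auto)
  show ?thesis
    unfolding step_prog_def
    by (rule computes_cong[OF computes_If[OF t1 computes_Skip
          computes_Seq[OF computes_ok[OF dom(2)] computes_If[OF t2 p computes_Skip]]]])
      (auto simp: step_def violation_test_def neq_test_def)
qed

lemma computes_overflow:
  assumes E: "E ''w'' = Some w" and dom: "''ok'' \<notin> dom E"
  shows "computes E overflow_prog (overflow w) 20 0"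
proof -
  have t: "eval (Sub (Var ''n'') (Cell ''p'' [Var ''w''])) s \<noteq> 0 \<longleftrightarrow> ptr (search_abs s) w < n"
    if s: "agrees E s" for s
    using agreesD(5)[OF s] E by (auto simp: search_abs_def agreesD(1)[OF s])
  show ?thesis
    unfolding overflow_prog_def
    by (rule computes_cong[OF computes_If[OF t computes_Skip computes_ok[OF dom]]])
      (auto simp: overflow_def)
qed

lemma computes_update:
  assumes E: "E ''w'' = Some w" and dom: "''best'' \<notin> dom E" "''worst'' \<notin> dom E"
  shows "computes E update_prog (update w) 60 0"
proof -
  have t1: "eval (Sub (Cell ''best'' [Var ''w'']) (Cell ''p'' [Var ''w''])) s \<noteq> 0 \<longleftrightarrow>
      ptr (search_abs s) w < best (search_abs s) w" if s: "agrees E s" for s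
    using agreesD(5)[OF s] E by (auto simp: search_abs_def)
  have t2: "eval (Sub (Cell ''p'' [Var ''w'']) (Cell ''worst'' [Var ''w''])) s \<noteq> 0 \<longleftrightarrow>
      worst (search_abs s) w < ptr (search_abs s) w" if s: "agrees E s" for s
    using agreesD(5)[OF s] E by (auto simp: search_abs_def)
  have e: "eval (Cell ''p'' [Var ''w'']) s = ptr (search_abs s) w" if s: "agrees E s" for s
    using agreesD(5)[OF s] E by (auto simp: search_abs_def)
  show ?thesis
    unfolding update_prog_def
    by (rule computes_cong[OF computes_Seq[OF
          computes_If[OF t1 computes_array(2)[OF E e dom(1) refl] computes_Skip]
          computes_If[OF t2 computes_array(3)[OF E e dom(2) refl] computes_Skip]]])
      (auto simp: update_def min_def max_def)
qed

lemma computes_output: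
  assumes E: "E ''w'' = Some w" "E ''f'' = Some f" and dom: "''wopt'' \<notin> dom E" "''fopt'' \<notin> dom E"
  shows "computes E output_prog (emit w f) 60 0"
proof -
  have t1: "eval (neq_test (Cell ''best'' [Var ''w'']) (Cell ''wrank'' [Const 0, Var ''w'', Var ''f''])) s
      \<noteq> 0 \<longleftrightarrow> best (search_abs s) w \<noteq> wrk 0 w f" if s: "agrees E s" for s
    using agreesD(5)[OF s] E by (auto simp: search_abs_def agreesD(3)[OF s])
  have t2: "eval (neq_test (Cell ''worst'' [Var ''w'']) (Cell ''wrank'' [Const 0, Var ''w'', Var ''f''])) s
      \<noteq> 0 \<longleftrightarrow> worst (search_abs s) w \<noteq> wrk 0 w f" if s: "agrees E s" for s
    using agreesD(5)[OF s] E by (auto simp: search_abs_def agreesD(3)[OF s])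
  have e: "eval (Var ''f'') s = f" if s: "agrees E s" for s
    using agreesD(5)[OF s] E by auto
  show ?thesis
    unfolding output_prog_def
    by (rule computes_cong[OF computes_Seq[OF
          computes_If[OF t1 computes_Skip computes_array(4)[OF E(1) e dom(1) refl]]
          computes_If[OF t2 computes_Skip computes_array(5)[OF E(1) e dom(2) refl]]]])
      (auto simp: emit_def neq_test_def)
qed

lemma computes_round:
  assumes E: "E ''v'' = Some v"
    and dom: "dom E \<subseteq> {''v'', ''r'', ''u'', ''q'', ''j'', ''l''}"
  shows "computes E round_prog (run_round v) 300 5"
proof -
  have notin: "x \<notin> dom E" if "x \<notin> {''v'', ''r'', ''u'', ''q'', ''j'', ''l''}" for x
    using dom that by blast
  have 0: "computes E (Assign ''ok'' [] (Const 1)) (\<lambda>x. x\<lparr>ok := 1\<rparr>) 2 0"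
    by (rule computes_ok) (simp add: notin)
  have 1: "computes E (For ''a'' ''n'' (For ''f'' ''n'' (For ''b'' ''n'' (For ''g'' ''n''
      (For ''i'' ''k'' step_prog))))) (sweep v) (100 + 16 + 16 + 16 + 16 + 16) (Suc (Suc (Suc (Suc (Suc 0)))))"
    unfolding sweep_def
    by (intro computes_For_n computes_For_k computes_step) (simp_all add: notin E)
  have 2: "computes E (For ''w'' ''n'' overflow_prog) (fold overflow [0..<n]) (20 + 16) (Suc 0)"
    by (intro computes_For_n computes_overflow) (simp_all add: notin E)
  show ?thesis
    unfolding round_prog_def
    by (rule computes_cong[OF computes_Seq[OF 0 computes_Seq[OF 1 2]]]) (auto simp: run_round_def)
qed

lemma computes_start:
  assumes E: "E ''v'' = Some v" "E ''r'' = Some r" "E ''u'' = Some u" "E ''q'' = Some q"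
    and dom: "dom E \<subseteq> {''v'', ''r'', ''u'', ''q''}"
  shows "computes E start_prog (start v r u q) 100 1"
proof -
  have notin: "x \<notin> dom E" if "x \<notin> {''v'', ''r'', ''u'', ''q''}" for x
    using dom that by blast
  have 1: "computes E (For ''w'' ''n'' (Assign ''p'' [Var ''w''] (Const 0)))
      (fold (\<lambda>w x. x\<lparr>ptr := (ptr x)(w := 0)\<rparr>) [0..<n]) (2 + expr_cost (Const 0) + 16) (Suc 0)"
    by (intro computes_For_n computes_array(1)) (simp_all add: notin)
  have 2: "computes E (Assign ''p'' [Var ''u''] (Var ''q'')) (\<lambda>x. x\<lparr>ptr := (ptr x)(u := q)\<rparr>)
      (2 + expr_cost (Var ''q'')) 0"
    using E by (intro computes_array(1)) (simp_all add: notin agreesD(5))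
  have 3: "computes E (Assign ''p'' [Var ''v''] (Var ''r'')) (\<lambda>x. x\<lparr>ptr := (ptr x)(v := r)\<rparr>)
      (2 + expr_cost (Var ''r'')) 0"
    using E by (intro computes_array(1)) (simp_all add: notin agreesD(5))
  show ?thesis
    unfolding start_prog_def
    by (rule computes_cong[OF computes_Seq[OF 1 computes_Seq[OF 2 3]]])
      (auto simp: start_def Let_def)
qed

lemma computes_trial:
  assumes E: "E ''v'' = Some v" "E ''r'' = Some r" "E ''u'' = Some u" "E ''q'' = Some q"
    and dom: "dom E \<subseteq> {''v'', ''r'', ''u'', ''q''}"
  shows "computes E trial_prog (trial v r u q) 1000 7"
proof -
  have notin: "x \<notin> dom E" if "x \<notin> {''v'', ''r'', ''u'', ''q''}" for x
    using dom that by blast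
  have t: "eval (Var ''ok'') s \<noteq> 0 \<longleftrightarrow> ok (search_abs s) \<noteq> 0" if "agrees E s" for s
    by (simp add: search_abs_def)
  have 1: "computes E (For ''j'' ''n'' (For ''l'' ''n'' round_prog))
      (fold (\<lambda>_. fold (\<lambda>_. run_round v) [0..<n]) [0..<n]) (300 + 16 + 16) (Suc (Suc 5))"
    using dom by (intro computes_For_n computes_round) (auto simp add: notin E)
  have 2: "computes E (For ''w'' ''n'' update_prog) (fold update [0..<n]) (60 + 16) (Suc 0)"
    by (intro computes_For_n computes_update) (simp_all add: notin E)
  have 3: "computes E (Assign ''found'' [] (Const 1)) (\<lambda>x. x\<lparr>found := 1\<rparr>) 2 0"
    by (rule computes_found) (simp add: notin)
  show ?thesis
    unfolding trial_prog_def
    by (rule computes_cong[OF computes_Seq[OF computes_start[OF E dom]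
          computes_Seq[OF 1 computes_If[OF t computes_Seq[OF 3 2] computes_Skip]]]])
      (auto simp: trial_def Let_def)
qed

text \<open>The degree counts nested loops: 5 in a round, 2 that repeat rounds and 4 over the
  guesses. Each loop runs at most \<open>n + k\<close> times.\<close>

lemma computes_search: "computes Map.empty search_prog run_search 2000 11"
proof -
  have 1: "computes Map.empty (For ''w'' ''n'' (Assign ''best'' [Var ''w''] (Var ''n'')))
      (fold (\<lambda>w x. x\<lparr>best := (best x)(w := n)\<rparr>) [0..<n]) (2 + expr_cost (Var ''n'') + 16) (Suc 0)"
    by (intro computes_For_n computes_array(2)) (auto simp: agreesD(1))
  have 2: "computes Map.empty (For ''v'' ''n'' (For ''r'' ''n'' (For ''u'' ''n'' (For ''q'' ''n'' trial_prog))))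
      trials (1000 + 16 + 16 + 16 + 16) (Suc (Suc (Suc (Suc 7))))"
    unfolding trials_def by (intro computes_For_n computes_trial) auto
  have 3: "computes Map.empty (For ''w'' ''n'' (For ''f'' ''n'' output_prog))
      (fold (\<lambda>w. fold (\<lambda>f. emit w f) [0..<n]) [0..<n]) (60 + 16 + 16) (Suc (Suc 0))"
    by (intro computes_For_n computes_output) auto
  show ?thesis
    unfolding search_prog_def
    by (rule computes_cong[OF computes_Seq[OF 1 computes_Seq[OF 2 3]]])
      (auto simp: run_search_def)
qed

end

section \<open>Correctness of the search\<close>

lemma pref_rank_less:
  assumes R: "strict_total_on {..<n} R" and ab: "a < n" "b < n"
  shows "pref_rank n R a < pref_rank n R b \<longleftrightarrow> R a b"
proof -
  have less: "pref_rank n R c < pref_rank n R d" if "R c d" "c < n" "d < n" for c d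
  proof -
    have "{b. b < n \<and> R b c} \<subset> {b. b < n \<and> R b d}"
      using that strict_total_onD(1)[OF R, of c] strict_total_onD(2)[OF R _ _ _ _ that(1)] by auto
    then show ?thesis unfolding pref_rank_def by (intro psubset_card_mono) auto
  qed
  show ?thesis
    using less[of a b] less[of b a] strict_total_onD(3)[OF R, of a b] ab by fastforce
qed

lemma pref_rank_inj:
  assumes R: "strict_total_on {..<n} R" and ab: "a < n" "b < n" and eq: "pref_rank n R a = pref_rank n R b"
  shows "a = b"
  using strict_total_onD(3)[OF R, of a b] pref_rank_less[OF R ab] pref_rank_less[OF R ab(2,1)] ab eq
  by auto

lemma pref_rank_bound:
  assumes R: "strict_total_on {..<n} R" and a: "a < n"
  shows "pref_rank n R a < n"
proof -
  have "{b. b < n \<and> R b a} \<subset> {..<n}" using strict_total_onD(1)[OF R, of a] a by auto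
  then have "card {b. b < n \<and> R b a} < card {..<n}" by (intro psubset_card_mono) auto
  then show ?thesis by (simp add: pref_rank_def)
qed

lemma pref_rank_surj:
  assumes R: "strict_total_on {..<n} R" and r: "r < n"
  shows "\<exists>a<n. pref_rank n R a = r"
proof -
  have "pref_rank n R ` {..<n} \<subseteq> {..<n}" using pref_rank_bound[OF R] by auto
  moreover have "inj_on (pref_rank n R) {..<n}"
    using pref_rank_inj[OF R] by (intro inj_onI) auto
  ultimately have "pref_rank n R ` {..<n} = {..<n}" by (intro endo_inj_surj) auto
  then have "r \<in> pref_rank n R ` {..<n}" using r by simp
  then show ?thesis by auto
qed

text \<open>Two choices of \<open>S\<close> will be made: for soundness of a round, that the flag \<open>ok\<close> is cleared;
  for completeness, that the sum of the pointers grows. Moves along \<open>R\<close> cannot undo it.\<close>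

definition progresses ::
  "('s \<Rightarrow> bool) \<Rightarrow> ('s \<Rightarrow> 's \<Rightarrow> bool) \<Rightarrow> ('s \<Rightarrow> 's \<Rightarrow> bool) \<Rightarrow> ('s \<Rightarrow> 's) \<Rightarrow> ('s \<Rightarrow> bool) \<Rightarrow> bool" where
  "progresses G R S \<phi> C \<longleftrightarrow>
     (\<forall>x. G x \<longrightarrow> G (\<phi> x) \<and> R x (\<phi> x) \<and> (if C x then \<phi> x = x else S x (\<phi> x)))"

text \<open>Until some condition fails the state is unchanged, so all conditions may be tested at
  the initial state; after the first failure \<open>S\<close> holds and survives the later moves
  along \<open>R\<close>.\<close>

lemma progresses_fold:
  assumes \<phi>: "\<And>j. j < N \<Longrightarrow> progresses G R S (\<phi> j) (C j)"
    and R: "\<And>x. R x x" "\<And>x y z. R x y \<Longrightarrow> R y z \<Longrightarrow> R x z"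
    and S: "\<And>x y z. S x y \<Longrightarrow> R y z \<Longrightarrow> S x z"
  shows "progresses G R S (fold \<phi> [0..<N]) (\<lambda>x. \<forall>j<N. C j x)"
  using \<phi>
proof (induction N)
  case 0
  then show ?case using R by (simp add: progresses_def)
next
  case (Suc N)
  have IH: "progresses G R S (fold \<phi> [0..<N]) (\<lambda>x. \<forall>j<N. C j x)" using Suc by simp
  have N: "progresses G R S (\<phi> N) (C N)" using Suc by simp
  show ?case
    unfolding progresses_def
  proof (intro allI impI)
    fix x assume x: "G x"
    let ?y = "fold \<phi> [0..<N] x"
    have y: "G ?y" "R x ?y" "if \<forall>j<N. C j x then ?y = x else S x ?y"
      using IH x by (auto simp: progresses_def)
    have z: "G (\<phi> N ?y)" "R ?y (\<phi> N ?y)" "if C N ?y then \<phi> N ?y = ?y else S ?y (\<phi> N ?y)"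
      using N y(1) by (auto simp: progresses_def)
    have "if \<forall>j<Suc N. C j x then \<phi> N ?y = x else S x (\<phi> N ?y)"
    proof (cases "\<forall>j<N. C j x")
      case True
      then show ?thesis using y(3) z(3) by (auto simp: less_Suc_eq)
    next
      case False
      then have "S x (\<phi> N ?y)" using y(3) z(2) S by metis
      then show ?thesis using False by (auto simp: less_Suc_eq)
    qed
    then show "G (fold \<phi> [0..<Suc N] x) \<and> R x (fold \<phi> [0..<Suc N] x) \<and>
        (if \<forall>j<Suc N. C j x then fold \<phi> [0..<Suc N] x = x else S x (fold \<phi> [0..<Suc N] x))"
      using z R(2)[OF y(2) z(2)] by simp
  qed
qed

text \<open>\<open>P\<close> is an invariant, \<open>Q\<close> a goal that persists once reached,
  and \<open>b\<close> marks a step that reaches it. \<open>b\<close> does not depend on the state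
  because it singles out loop indices, namely the right guess.\<close>

definition attains :: "('s \<Rightarrow> bool) \<Rightarrow> ('s \<Rightarrow> bool) \<Rightarrow> ('s \<Rightarrow> 's) \<Rightarrow> bool \<Rightarrow> bool" where
  "attains P Q \<phi> b \<longleftrightarrow> (\<forall>x. P x \<longrightarrow> P (\<phi> x) \<and> (Q x \<or> b \<longrightarrow> Q (\<phi> x)))"

lemma attainsI:
  "(\<And>x. P x \<Longrightarrow> P (\<phi> x)) \<Longrightarrow> (\<And>x. P x \<Longrightarrow> Q x \<or> b \<Longrightarrow> Q (\<phi> x)) \<Longrightarrow> attains P Q \<phi> b"
  by (auto simp: attains_def)

lemma attains_fold:
  assumes "\<And>j. j < N \<Longrightarrow> attains P Q (\<phi> j) (b j)"
  shows "attains P Q (fold \<phi> [0..<N]) (\<exists>j<N. b j)"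
  using assms
proof (induction N)
  case (Suc N)
  then have "attains P Q (fold \<phi> [0..<N]) (\<exists>j<N. b j)" "attains P Q (\<phi> N) (b N)" by simp_all
  then show ?case by (auto simp: attains_def less_Suc_eq)
qed (simp add: attains_def)

lemma fold_const_upt: "fold (\<lambda>_. \<phi>) [0..<N] = \<phi> ^^ N"
  by (induction N) auto

section \<open>Soundness of rounds and trials\<close>

context common_search
begin

text \<open>For strict preferences no firm has rank \<open>n\<close> or more, so an out-of-range
  pointer occurs in no violation; \<open>overflow\<close> checks the range separately.\<close>

definition stable_ptr :: "(nat \<Rightarrow> nat) \<Rightarrow> bool" where
  "stable_ptr p \<longleftrightarrow> (\<forall>a<n. \<forall>f<n. \<forall>b<n. \<forall>g<n. \<forall>i<k. \<not> violation p a f b g i)"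

lemma progresses_sweep:
  assumes "\<And>a f b g i. \<lbrakk>a < n; f < n; b < n; g < n; i < k\<rbrakk> \<Longrightarrow>
      progresses G R S (step v a f b g i) (\<lambda>x. \<not> violation (ptr x) a f b g i)"
    and "\<And>x. R x x" "\<And>x y z. R x y \<Longrightarrow> R y z \<Longrightarrow> R x z" "\<And>x y z. S x y \<Longrightarrow> R y z \<Longrightarrow> S x z"
  shows "progresses G R S (sweep v) (\<lambda>x. stable_ptr (ptr x))"
  unfolding sweep_def stable_ptr_def
  by (intro progresses_fold assms(1)) (assumption | rule assms(2) | erule (1) assms(3) | erule (1) assms(4))+

text \<open>Pointers move only together with clearing \<open>ok\<close>, and after its
  initialisation nothing in a round sets the flag again. If it survives, all tests were made at the
  final pointers.\<close>

lemma run_round_sound: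
  assumes y: "y = run_round v x"
  shows "found y = found x \<and> best y = best x \<and> worst y = worst x \<and>
    (ok y \<noteq> 0 \<longrightarrow> stable_ptr (ptr y) \<and> (\<forall>a<n. ptr y a < n))"
proof -
  let ?G = "\<lambda>z :: search_state. found z = found x \<and> best z = best x \<and> worst z = worst x"
  let ?R = "\<lambda>x y :: search_state. ok x = 0 \<longrightarrow> ok y = 0" and ?S = "\<lambda>x y :: search_state. ok y = 0"
  have sweep: "progresses ?G ?R ?S (sweep v) (\<lambda>x. stable_ptr (ptr x))"
    by (rule progresses_sweep) (auto simp: progresses_def step_def)
  have over: "progresses ?G ?R ?S (fold overflow [0..<n]) (\<lambda>x. \<forall>a<n. ptr x a < n)"
    by (rule progresses_fold) (auto simp: progresses_def overflow_def)
  define s where "s = sweep v (x\<lparr>ok := 1\<rparr>)"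
  have s: "?G s" "if stable_ptr (ptr x) then s = x\<lparr>ok := 1\<rparr> else ok s = 0"
    using sweep[unfolded progresses_def, rule_format, of "x\<lparr>ok := 1\<rparr>"]
    by (auto simp: s_def split: if_splits)
  have "y = fold overflow [0..<n] s" by (simp add: y run_round_def s_def)
  then have "?G y" "ok s = 0 \<longrightarrow> ok y = 0" "if \<forall>a<n. ptr s a < n then y = s else ok y = 0"
    using over[unfolded progresses_def, rule_format, of s] s(1) by (auto split: if_splits)
  then show ?thesis using s(2) by (auto split: if_splits)
qed

definition rounds :: "nat \<Rightarrow> search_state \<Rightarrow> search_state" where
  "rounds v = fold (\<lambda>_. fold (\<lambda>_. run_round v) [0..<n]) [0..<n]"

lemma rounds_eq: "rounds v = run_round v ^^ (n * n)"
  by (simp add: rounds_def fold_const_upt funpow_mult)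

text \<open>The last round alone decides the flag, and \<open>0 < n\<close> ensures that there is
  one.\<close>

lemma rounds_sound:
  assumes y: "y = rounds v x"
  shows "found y = found x \<and> best y = best x \<and> worst y = worst x \<and>
    (ok y \<noteq> 0 \<longrightarrow> stable_ptr (ptr y) \<and> (\<forall>a<n. ptr y a < n))"
proof -
  have G: "found ((run_round v ^^ j) x) = found x \<and> best ((run_round v ^^ j) x) = best x \<and>
    worst ((run_round v ^^ j) x) = worst x" for j
    by (induction j) (auto simp: run_round_sound[OF refl])
  obtain j where "n * n = Suc j" using n_pos by (cases "n * n") auto
  then have "y = run_round v ((run_round v ^^ j) x)" by (simp add: y rounds_eq)
  from run_round_sound[OF this] G[of j] show ?thesis by simp
qed

lemma start_eq:
  "found (start v r u q x) = found x" "best (start v r u q x) = best x"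
  "worst (start v r u q x) = worst x"
  "w < n \<Longrightarrow> ptr (start v r u q x) w = (if w = v then r else if w = u then q else 0)"
proof -
  have f: "fold (\<lambda>w x. x\<lparr>ptr := (ptr x)(w := 0)\<rparr>) [0..<N] x =
      x\<lparr>ptr := \<lambda>w. if w < N then 0 else ptr x w\<rparr>" for N and x :: search_state
    by (induction N) (auto simp: less_Suc_eq fun_eq_iff)
  show "found (start v r u q x) = found x" "best (start v r u q x) = best x"
    "worst (start v r u q x) = worst x"
    "w < n \<Longrightarrow> ptr (start v r u q x) w = (if w = v then r else if w = u then q else 0)"
    by (simp_all add: start_def f)
qed

lemma fold_update:
  "fold update [0..<N] x = x\<lparr>best := \<lambda>w. if w < N then min (best x w) (ptr x w) else best x w,
     worst := \<lambda>w. if w < N then max (worst x w) (ptr x w) else worst x w\<rparr>"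
  by (induction N) (auto simp: update_def less_Suc_eq fun_eq_iff)

lemma trial_eq:
  assumes y: "y = rounds v (start v r u q x)" and z: "z = trial v r u q x"
  shows "if ok y \<noteq> 0 then found z = 1 \<and>
      (\<forall>w<n. best z w = min (best x w) (ptr y w) \<and> worst z w = max (worst x w) (ptr y w))
    else found z = found x \<and> best z = best x \<and> worst z = worst x"
proof -
  have "z = (if ok y \<noteq> 0 then fold update [0..<n] (y\<lparr>found := 1\<rparr>) else y)"
    unfolding z y trial_def rounds_def by (simp add: Let_def)
  then show ?thesis using rounds_sound[OF y] by (simp add: start_eq fold_update)
qed

end

section \<open>Pointers versus common stable matchings\<close>

locale one_worker_search = one_worker "{..<n}" "{..<n}" k A w0
  for n k :: nat and A :: "nat \<Rightarrow> (nat, nat) sm_instance" and w0 :: nat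
begin

sublocale common_search n k A
  using w0 k0 by unfold_locales auto

abbreviation L :: "(nat \<Rightarrow> nat) set" where
  "L \<equiv> common_stable {..<n} {..<n} k A"

definition rk :: "(nat \<Rightarrow> nat) \<Rightarrow> nat \<Rightarrow> nat" where
  "rk M w = wrk 0 w (M w)"

lemma wrk_eq: "i < k \<Longrightarrow> w < n \<Longrightarrow> f < n \<Longrightarrow> wrk i w f = pref_rank n (wpref (A i) w) f"
  by (simp add: wrk_def input_def)

lemma frk_eq: "i < k \<Longrightarrow> f < n \<Longrightarrow> w < n \<Longrightarrow> frk i f w = pref_rank n (fpref (A i) f) w"
  by (simp add: frk_def input_def)

lemma wpref_total: "i < k \<Longrightarrow> w < n \<Longrightarrow> strict_total_on {..<n} (wpref (A i) w)"
  using is_instanceD(1)[OF insts] by simp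

lemma fpref_total: "i < k \<Longrightarrow> f < n \<Longrightarrow> strict_total_on {..<n} (fpref (A i) f)"
  using is_instanceD(2)[OF insts] by simp

lemma wrk_less: "i < k \<Longrightarrow> w < n \<Longrightarrow> f < n \<Longrightarrow> g < n \<Longrightarrow> wrk i w f < wrk i w g \<longleftrightarrow> wpref (A i) w f g"
  by (simp add: wrk_eq pref_rank_less[OF wpref_total])

lemma frk_less: "i < k \<Longrightarrow> f < n \<Longrightarrow> v < n \<Longrightarrow> w < n \<Longrightarrow> frk i f v < frk i f w \<longleftrightarrow> fpref (A i) f v w"
  by (simp add: frk_eq pref_rank_less[OF fpref_total])

lemma wrk_inj: "i < k \<Longrightarrow> w < n \<Longrightarrow> f < n \<Longrightarrow> g < n \<Longrightarrow> wrk i w f = wrk i w g \<longleftrightarrow> f = g"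
  using pref_rank_inj[OF wpref_total] by (auto simp: wrk_eq)

lemma wrk_common:
  assumes "i < k" "w < n" "w \<noteq> w0" "f < n"
  shows "wrk i w f = wrk 0 w f"
proof -
  have "{b. b < n \<and> wpref (A i) w b f} = {b. b < n \<and> wpref (A 0) w b f}"
    using common[of w i 0 _ f] assms k0 by auto
  then show ?thesis using assms k0 by (simp add: wrk_eq pref_rank_def)
qed

lemma L_less: "M \<in> L \<Longrightarrow> w < n \<Longrightarrow> M w < n"
  using common_in[of M w] by simp

lemma rk_bound: "M \<in> L \<Longrightarrow> w < n \<Longrightarrow> rk M w < n"
  using pref_rank_bound[OF wpref_total[OF k0]] L_less k0 by (simp add: rk_def wrk_eq)

text \<open>Ranks are onto, so pointers decode to firms; \<open>stable_iff\<close> then asks for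
  exactly the pairwise condition that excludes violations, including those in which two workers
  share a firm.\<close>

lemma stable_ptr_common:
  assumes p: "stable_ptr p" "\<forall>a<n. p a < n"
  shows "\<exists>M\<in>L. \<forall>w<n. rk M w = p w"
proof -
  have "\<exists>f<n. wrk 0 a f = p a" if "a < n" for a
    using pref_rank_surj[OF wpref_total[OF k0 that], of "p a"] p(2) that k0 by (auto simp: wrk_eq)
  then obtain h where h: "\<And>a. a < n \<Longrightarrow> h a < n \<and> wrk 0 a (h a) = p a" by metis
  let ?M = "\<lambda>a\<in>{..<n}. h a"
  have "?M \<in> stable_matchings {..<n} {..<n} (A i)" if i: "i < k" for i
    unfolding matching_instance.stable_iff[OF matching_instance[OF i]]
  proof (intro conjI ballI impI)
    show "?M \<in> {..<n} \<rightarrow>\<^sub>E {..<n}" using h by auto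
  next
    fix a b assume ab: "a \<in> {..<n}" "b \<in> {..<n}" and pr: "fpref (A i) (?M a) b a"
    have "\<not> violation p a (h a) b (h b) i"
      using p(1) ab h i by (auto simp: stable_ptr_def)
    then have less: "wrk i b (h b) < wrk i b (h a)"
      using ab h pr i by (auto simp: violation_def frk_less)
    then have "h a \<noteq> h b" by auto
    then show "?M a \<noteq> ?M b" using ab by simp
    have "\<not> wrk i b (h a) < wrk i b (h b)" using less by simp
    then show "\<not> wpref (A i) b (?M a) (?M b)" using ab h i by (auto simp: wrk_less)
  qed
  then have "?M \<in> L" by (auto simp: common_stable_def)
  then show ?thesis using h by (intro bexI[of _ ?M]) (auto simp: rk_def)
qed

text \<open>As long as the pointers stay at or above a common stable matching \<open>N\<close> and \<open>w0\<close> already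
  points to her partner in \<open>N\<close>, a violation at \<open>a\<close> shows that \<open>a\<close> has to move on: otherwise
  \<open>(b, f)\<close> would block \<open>N\<close>.\<close>

lemma violation_below:
  assumes N: "N \<in> L" and p: "\<forall>w<n. p w \<le> rk N w" "p w0 = rk N w0"
    and viol: "violation p a f b g i" and b: "a < n" "f < n" "b < n" "g < n" "i < k"
  shows "a \<noteq> w0 \<and> p a < rk N a"
proof -
  have v: "p a = wrk 0 a f" "p b = wrk 0 b g" "frk i f b < frk i f a" "wrk i b f \<le> wrk i b g"
    using viol by (auto simp: violation_def)
  have Na: "N a < n" "N b < n" using L_less[OF N] b by auto
  have "p a \<noteq> rk N a"
  proof
    assume "p a = rk N a"
    then have f: "f = N a" using v(1) wrk_inj[OF k0 b(1,2) Na(1)] by (simp add: rk_def)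
    have "fpref (A i) (N a) b a" using v(3) f b by (simp add: frk_less)
    then have "wpref (A i) b (N b) f"
      using matching_instance.stableD[OF matching_instance[OF b(5)] common_stableD[OF N b(5)], of a b] b f
      by simp
    \<comment> \<open>In \<open>A i\<close>, \<open>b\<close> ranks \<open>N b\<close> above
      \<open>f\<close>, and \<open>f\<close> no lower than \<open>g\<close>.\<close>
    then have less: "wrk i b (N b) < wrk i b g" using v(4) b Na by (simp add: wrk_less[symmetric])
    \<comment> \<open>Only the list of \<open>w0\<close> can differ between \<open>A i\<close> and
      \<open>A 0\<close>, and there the pointer is exact, so \<open>g = N b\<close>. For any other
      worker the inequality carries over to \<open>A 0\<close>, and the pointer would have passed
      \<open>N\<close>.\<close>
    show False
    proof (cases "b = w0")
      case True
      then have "wrk 0 b g = wrk 0 b (N b)" using p(2) v(2) by (simp add: rk_def)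
      then have "g = N b" using wrk_inj[OF k0 b(3,4) Na(2)] by simp
      then show False using less by simp
    next
      case False
      then have "rk N b < p b" using less wrk_common[OF b(5,3)] b Na v(2) by (simp add: rk_def)
      then show False using p(1) b by fastforce
    qed
  qed
  then have "p a < rk N a" using p(1) b by (simp add: order.strict_iff_order)
  then show ?thesis using p(2) by auto
qed

text \<open>By \<open>violation_below\<close> every advance is forced, so no pointer passes
  \<open>N\<close>. Each advance raises the sum of the pointers, which measures progress.\<close>

lemma run_round_complete:
  assumes N: "N \<in> L" and x: "\<forall>w<n. ptr x w \<le> rk N w" "ptr x w0 = rk N w0" "q \<le> ptr x u"
    and y: "y = run_round w0 x"
  shows "(\<forall>w<n. ptr y w \<le> rk N w) \<and> ptr y w0 = rk N w0 \<and> q \<le> ptr y u \<and>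
    (if stable_ptr (ptr x) then y = x\<lparr>ok := 1\<rparr> else (\<Sum>w<n. ptr x w) < (\<Sum>w<n. ptr y w))"
proof -
  let ?G = "\<lambda>z :: search_state. (\<forall>w<n. ptr z w \<le> rk N w) \<and> ptr z w0 = rk N w0 \<and> q \<le> ptr z u"
  let ?R = "\<lambda>x y :: search_state. \<forall>w. ptr x w \<le> ptr y w"
  let ?S = "\<lambda>x y :: search_state. (\<Sum>w<n. ptr x w) < (\<Sum>w<n. ptr y w)"
  have sweep: "progresses ?G ?R ?S (sweep w0) (\<lambda>x. stable_ptr (ptr x))"
  proof (rule progresses_sweep)
    fix a f b g i assume b: "a < n" "f < n" "b < n" "g < n" "i < k"
    show "progresses ?G ?R ?S (step w0 a f b g i) (\<lambda>x. \<not> violation (ptr x) a f b g i)"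
      unfolding progresses_def
    proof (intro allI impI)
      fix z assume z: "?G z"
      show "?G (step w0 a f b g i z) \<and> ?R z (step w0 a f b g i z) \<and>
        (if \<not> violation (ptr z) a f b g i then step w0 a f b g i z = z else ?S z (step w0 a f b g i z))"
      proof (cases "violation (ptr z) a f b g i")
        case True
        then have a: "a \<noteq> w0" "ptr z a < rk N a"
          using violation_below[OF N _ _ True b] z by auto
        then have "ptr (step w0 a f b g i z) = (ptr z)(a := ptr z a + 1)"
          using True by (simp add: step_def)
        moreover have "(\<Sum>w<n. ptr z w) < (\<Sum>w<n. ((ptr z)(a := ptr z a + 1)) w)"
          using b by (intro sum_strict_mono_ex1) auto
        ultimately show ?thesis using True z a by auto
      qed (use z in \<open>auto simp: step_def\<close>)
    qed
  next
    fix x y z assume "?S x y" "?R y z"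
    then show "?S x z" by (meson less_le_trans sum_mono)
  qed (auto intro: order_trans)
  define s where "s = sweep w0 (x\<lparr>ok := 1\<rparr>)"
  have s: "?G s" "if stable_ptr (ptr x) then s = x\<lparr>ok := 1\<rparr> else ?S x s"
    using sweep[unfolded progresses_def, rule_format, of "x\<lparr>ok := 1\<rparr>"] x
    by (auto simp: s_def split: if_splits)
  \<comment> \<open>Pointers bounded by the ranks of \<open>N\<close> are in range, so
    \<open>overflow\<close> does nothing.\<close>
  have "ptr s a < n" if "a < n" for a using s(1) rk_bound[OF N that] that by (meson le_less_trans)
  then have "fold overflow [0..<m] s = s" if "m \<le> n" for m
    using that by (induction m) (auto simp: overflow_def)
  then have "y = s" by (simp add: y run_round_def s_def)
  then show ?thesis using s by simp
qed

lemma rounds_complete: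
  assumes N: "N \<in> L" and x: "\<forall>w<n. ptr x w \<le> rk N w" "ptr x w0 = rk N w0" "q \<le> ptr x u"
    and y: "y = rounds w0 x"
  shows "(\<forall>w<n. ptr y w \<le> rk N w) \<and> q \<le> ptr y u \<and> ok y = 1"
proof -
  let ?y = "\<lambda>j. (run_round w0 ^^ j) x"
  \<comment> \<open>Each round either raises the sum or finds stable pointers, which later rounds
    keep. The sum is at most \<open>n * (n - 1)\<close>, so after \<open>n * n\<close> rounds the
    second case holds.\<close>
  have inv: "(\<forall>w<n. ptr (?y j) w \<le> rk N w) \<and> ptr (?y j) w0 = rk N w0 \<and> q \<le> ptr (?y j) u \<and>
     (j \<le> (\<Sum>w<n. ptr (?y j) w) \<or> stable_ptr (ptr (?y j)) \<and> ok (?y j) = 1)" for j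
  proof (induction j)
    case (Suc j)
    then show ?case using run_round_complete[OF N, of "?y j" q u "?y (Suc j)"]
      by (auto split: if_splits)
  qed (use x in auto)
  have "(\<Sum>w<n. ptr y w) \<le> (\<Sum>w<n. n - 1)"
    using inv[of "n * n"] rk_bound[OF N] by (intro sum_mono) (fastforce simp: y rounds_eq)
  also have "\<dots> < n * n" using n_pos by (cases n) auto
  finally show ?thesis using inv[of "n * n"] by (auto simp: y rounds_eq)
qed

text \<open>Wrong guesses are harmless: a surviving flag always certifies a member of
  \<open>L\<close>, and otherwise nothing is recorded.\<close>

lemma trial_sound:
  assumes z: "z = trial v r u q x"
  shows "found z = found x \<and> best z = best x \<and> worst z = worst x \<or>
    (\<exists>M\<in>L. found z = 1 \<and>
      (\<forall>w<n. best z w = min (best x w) (rk M w) \<and> worst z w = max (worst x w) (rk M w)))"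
proof -
  define y where "y = rounds v (start v r u q x)"
  show ?thesis
  proof (cases "ok y = 0")
    case False
    then obtain M where M: "M \<in> L" "\<forall>w<n. rk M w = ptr y w"
      using rounds_sound[OF y_def] stable_ptr_common by blast
    then show ?thesis using trial_eq[OF y_def z] False by (intro disjI2 bexI[OF _ M(1)]) simp
  qed (use trial_eq[OF y_def z] in simp)
qed

text \<open>The pointers start at or below the ranks in \<open>N\<close> and only rise, so the
  matching found lies between start and \<open>N\<close>. For \<open>q = rk N u\<close> the partner
  of \<open>u\<close> is thereby pinned to the one in \<open>N\<close>.\<close>

lemma trial_complete:
  assumes N: "N \<in> L" and u: "u < n" "q \<le> rk N u" and z: "z = trial w0 (rk N w0) u q x"
  shows "\<exists>M\<in>L. (\<forall>w<n. rk M w \<le> rk N w) \<and> q \<le> rk M u \<and> found z = 1 \<and>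
      (\<forall>w<n. best z w = min (best x w) (rk M w) \<and> worst z w = max (worst x w) (rk M w))"
proof -
  define y where "y = rounds w0 (start w0 (rk N w0) u q x)"
  have y: "(\<forall>w<n. ptr y w \<le> rk N w) \<and> q \<le> ptr y u \<and> ok y = 1"
    using u w0 by (intro rounds_complete[OF N _ _ _ y_def]) (auto simp: start_eq)
  then obtain M where M: "M \<in> L" "\<forall>w<n. rk M w = ptr y w"
    using rounds_sound[OF y_def] stable_ptr_common[of "ptr y"] by (metis zero_neq_one)
  then show ?thesis using trial_eq[OF y_def z] y u by (intro bexI[OF _ M(1)]) auto
qed

section \<open>Extremal common stable matchings\<close>

lemma ex_extremal:
  assumes L: "L \<noteq> {}"
  shows "\<exists>M\<in>L. \<forall>N\<in>L. match_meet {..<n} (A 0) M N = M"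
    and "\<exists>M\<in>L. \<forall>N\<in>L. match_join {..<n} (A 0) M N = M"
proof -
  have fin: "finite L"
  proof (rule finite_subset)
    show "L \<subseteq> {..<n} \<rightarrow>\<^sub>E {..<n}"
      using common_stableD[OF _ k0] matching_instance.stable_iff[OF matching_instance[OF k0]] by blast
  qed (simp add: finite_PiE)
  note meet = matching_instance.match_meet_cases[OF matching_instance[OF k0]
      common_stableD[OF _ k0] common_stableD[OF _ k0]]
  note join = matching_instance.match_join_cases[OF matching_instance[OF k0]
      common_stableD[OF _ k0] common_stableD[OF _ k0]]
  let ?s = "\<lambda>M. \<Sum>w<n. rk M w"
  have eq: "M = N" if "M \<in> L" "N \<in> L" "?s M = ?s N" and le: "\<And>w. w < n \<Longrightarrow> rk M w \<le> rk N w" for M N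
  proof -
    have "rk M w = rk N w" if "w < n" for w
      using sum_mono_inv[OF \<open>?s M = ?s N\<close>] le that by auto
    then have "M w = N w" if "w < n" for w
      using wrk_inj[OF k0 that L_less[OF \<open>M \<in> L\<close> that] L_less[OF \<open>N \<in> L\<close> that]] that by (simp add: rk_def)
    moreover have "M \<in> extensional {..<n}" "N \<in> extensional {..<n}"
      using stable_matchings_perfect[OF common_stableD[OF _ k0]] that by (auto simp: perfect_matching_def)
    ultimately show ?thesis by (intro extensionalityI[of M "{..<n}" N]) auto
  qed
  \<comment> \<open>A minimiser of the rank sum is the least element: its meet with any
    \<open>N\<close> has pointwise no larger ranks, hence the same sum, and \<open>eq\<close>
    identifies the two. The join is dual, with a maximiser.\<close>
  obtain M where M: "M \<in> L" "\<And>N. N \<in> L \<Longrightarrow> ?s M \<le> ?s N"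
    using ex_min_if_finite[of "?s ` L"] fin L by (auto simp: not_less)
  have "match_meet {..<n} (A 0) M N = M" if N: "N \<in> L" for N
  proof -
    let ?J = "match_meet {..<n} (A 0) M N"
    have J: "?J \<in> L" by (rule common_closed(2)[OF M(1) N k0])
    have le: "rk ?J w \<le> rk M w" if w: "w < n" for w
      using meet[OF M(1) N, of w] w wrk_less[OF k0 w L_less[OF N w] L_less[OF M(1) w]]
      by (auto simp: rk_def)
    have "?s ?J \<le> ?s M" using le by (intro sum_mono) simp
    then have "?s ?J = ?s M" using M(2)[OF J] by simp
    then show ?thesis using eq[OF J M(1)] le by blast
  qed
  then show "\<exists>M\<in>L. \<forall>N\<in>L. match_meet {..<n} (A 0) M N = M" using M(1) by blast
  obtain M where M: "M \<in> L" "\<And>N. N \<in> L \<Longrightarrow> ?s N \<le> ?s M"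
    using Max_in[of "?s ` L"] Max_ge[of "?s ` L"] fin L by fastforce
  have "match_join {..<n} (A 0) M N = M" if N: "N \<in> L" for N
  proof -
    let ?J = "match_join {..<n} (A 0) M N"
    have J: "?J \<in> L" by (rule common_closed(1)[OF M(1) N k0])
    have le: "rk M w \<le> rk ?J w" if w: "w < n" for w
      using join[OF M(1) N, of w] w wrk_less[OF k0 w L_less[OF M(1) w] L_less[OF N w]]
      by (auto simp: rk_def)
    have "?s M \<le> ?s ?J" using le by (intro sum_mono) simp
    then have "?s M = ?s ?J" using M(2)[OF J] by simp
    then show ?thesis using eq[OF M(1) J] le by auto
  qed
  then show "\<exists>M\<in>L. \<forall>N\<in>L. match_join {..<n} (A 0) M N = M" using M(1) by blast
qed

text \<open>Optimality passes from \<open>A 0\<close> to \<open>A i\<close> through the common meet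
  rather than through ranks, since \<open>w0\<close> may rank firms differently in the two
  instances.\<close>

lemma worker_best:
  assumes M: "M \<in> L" and meet: "\<forall>N\<in>L. match_meet {..<n} (A 0) M N = M" and i: "i < k"
  shows "worker_optimal {..<n} (A i) L M"
proof -
  have "M w = N w \<or> wpref (A i) w (M w) (N w)" if N: "N \<in> L" and w: "w < n" for N w
  proof -
    have "match_meet {..<n} (A i) M N = M"
      using common_join_meet_eq(2)[OF M N i k0] meet N by simp
    then show ?thesis
      using matching_instance.match_meet_cases[OF matching_instance[OF i] common_stableD[OF M i]
          common_stableD[OF N i], of w] w by auto
  qed
  then show ?thesis using M by (auto simp: worker_optimal_def)
qed

lemma worker_worst:
  assumes M: "M \<in> L" and join: "\<forall>N\<in>L. match_join {..<n} (A 0) M N = M" and i: "i < k"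
    and N: "N \<in> L" and w: "w < n"
  shows "M w = N w \<or> wpref (A i) w (N w) (M w)"
proof -
  have "match_join {..<n} (A i) M N = M"
    using common_join_meet_eq(1)[OF M N i k0] join N by simp
  then show ?thesis
    using matching_instance.match_join_cases[OF matching_instance[OF i] common_stableD[OF M i]
        common_stableD[OF N i], of w] w by auto
qed

lemma firm_best:
  assumes M: "M \<in> L" and join: "\<forall>N\<in>L. match_join {..<n} (A 0) M N = M" and i: "i < k"
  shows "firm_optimal {..<n} {..<n} (A i) L M"
  unfolding firm_optimal_def
proof (intro conjI ballI M)
  fix N f assume N: "N \<in> L" and f: "f \<in> {..<n}"
  show "inv_into {..<n} M f = inv_into {..<n} N f \<or>
      fpref (A i) f (inv_into {..<n} M f) (inv_into {..<n} N f)"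
    using worker_worst[OF M join i N]
    by (intro matching_instance.firm_prefers_if_workers_dislike[OF matching_instance[OF i]
          common_stableD[OF M i] common_stableD[OF N i] _ f]) auto
qed

section \<open>Correctness of the whole search\<close>

lemma found_emit:
  "found (fold (\<lambda>w. fold (\<lambda>f. emit w f) [0..<n]) [0..<n] x) = found x"
proof -
  have "attains (\<lambda>y. found y = found x) (\<lambda>_. True) (fold (\<lambda>w. fold (\<lambda>f. emit w f) [0..<n]) [0..<n])
      (\<exists>w<n. \<exists>f<n. True)"
    by (intro attains_fold) (simp add: attains_def emit_def)
  then show ?thesis by (auto simp: attains_def)
qed

lemma attains_trials:
  assumes "\<And>v r u q. attains P Q (trial v r u q) (b v r u q)"
  shows "attains P Q trials (\<exists>v<n. \<exists>r<n. \<exists>u<n. \<exists>q<n. b v r u q)"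
  unfolding trials_def by (intro attains_fold assms)

lemma fold_init:
  "fold (\<lambda>w x. x\<lparr>best := (best x)(w := n)\<rparr>) [0..<N] x = x\<lparr>best := \<lambda>w. if w < N then n else best x w\<rparr>"
  by (induction N) (auto simp: less_Suc_eq fun_eq_iff)

lemma run_search_empty:
  assumes L: "L = {}"
  shows "found (run_search x) = found x"
proof -
  have "attains (\<lambda>y. found y = found x) (\<lambda>_. True) trials (\<exists>v<n. \<exists>r<n. \<exists>u<n. \<exists>q<n. True)"
    using trial_sound[OF refl] L by (intro attains_trials) (auto simp: attains_def)
  then show ?thesis by (auto simp: attains_def run_search_def found_emit fold_init)
qed

lemma run_search_nonempty:
  assumes T: "T \<in> L" "\<And>N w. N \<in> L \<Longrightarrow> w < n \<Longrightarrow> rk T w \<le> rk N w"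
    and B: "B \<in> L" "\<And>N w. N \<in> L \<Longrightarrow> w < n \<Longrightarrow> rk N w \<le> rk B w"
    and x: "\<forall>w<n. worst x w = 0" and y: "y = run_search x"
  shows "found y = 1 \<and> (\<forall>w<n. wopt y w = T w \<and> fopt y w = B w)"
proof -
  define s where "s = x\<lparr>best := \<lambda>w. if w < n then n else best x w\<rparr>"
  \<comment> \<open>Bounds that no trial can cross, as every recorded matching belongs to
    \<open>L\<close>.\<close>
  let ?P = "\<lambda>z :: search_state. \<forall>w<n. rk T w \<le> best z w \<and> worst z w \<le> rk B w"
  have P0: "?P s" using x rk_bound[OF T(1)] by (auto simp: s_def less_imp_le)
  have pres: "?P z \<Longrightarrow> ?P (trial v r u q z)" for z v r u q
    using trial_sound[OF refl, of v r u q z] T B by auto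
  have w0n: "w0 < n" using w0 by simp
  \<comment> \<open>With \<open>u = v = w0\<close> the rank \<open>q\<close> is overwritten, so all
    other workers start at 0. This one trial finds a matching at least as good as \<open>T\<close>
    for every worker.\<close>
  have 1: "attains ?P (\<lambda>z. found z = 1 \<and> (\<forall>w<n. best z w \<le> rk T w)) trials
     (\<exists>v<n. \<exists>r<n. \<exists>u<n. \<exists>q<n. v = w0 \<and> r = rk T w0 \<and> u = w0 \<and> q = 0)"
  proof (rule attains_trials)
    fix v r u q
    show "attains ?P (\<lambda>z. found z = 1 \<and> (\<forall>w<n. best z w \<le> rk T w)) (trial v r u q)
        (v = w0 \<and> r = rk T w0 \<and> u = w0 \<and> q = 0)"
    proof (rule attainsI)
      show "?P z \<Longrightarrow> ?P (trial v r u q z)" for z by (rule pres)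
    next
      fix z :: search_state
      assume *: "(found z = 1 \<and> (\<forall>w<n. best z w \<le> rk T w)) \<or> v = w0 \<and> r = rk T w0 \<and> u = w0 \<and> q = 0"
      from * show "found (trial v r u q z) = 1 \<and> (\<forall>w<n. best (trial v r u q z) w \<le> rk T w)"
      proof
        assume "found z = 1 \<and> (\<forall>w<n. best z w \<le> rk T w)"
        then show ?thesis
          using trial_sound[OF refl, of v r u q z] by (auto simp: min_le_iff_disj)
      next
        assume "v = w0 \<and> r = rk T w0 \<and> u = w0 \<and> q = 0"
        then show ?thesis
          using trial_complete[OF T(1) w0n le0 refl, of z] by (auto simp: min_le_iff_disj)
      qed
    qed
  qed
  \<comment> \<open>A trial guided by \<open>B\<close> yields the best matching respecting its
    guess, which need not be \<open>B\<close>. Hence each worker \<open>a\<close> has its own trial,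
    with \<open>q = rk B a\<close> forcing \<open>a\<close> down to its partner in
    \<open>B\<close>.\<close>
  have 2: "attains ?P (\<lambda>z. rk B a \<le> worst z a) trials
     (\<exists>v<n. \<exists>r<n. \<exists>u<n. \<exists>q<n. v = w0 \<and> r = rk B w0 \<and> u = a \<and> q = rk B a)" if a: "a < n" for a
  proof (rule attains_trials)
    fix v r u q
    show "attains ?P (\<lambda>z. rk B a \<le> worst z a) (trial v r u q)
        (v = w0 \<and> r = rk B w0 \<and> u = a \<and> q = rk B a)"
    proof (rule attainsI)
      show "?P z \<Longrightarrow> ?P (trial v r u q z)" for z by (rule pres)
    next
      fix z :: search_state
      assume *: "rk B a \<le> worst z a \<or> v = w0 \<and> r = rk B w0 \<and> u = a \<and> q = rk B a"
      from * show "rk B a \<le> worst (trial v r u q z) a"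
      proof
        assume "rk B a \<le> worst z a"
        then show ?thesis
          using trial_sound[OF refl, of v r u q z] a by (auto simp: le_max_iff_disj)
      next
        assume "v = w0 \<and> r = rk B w0 \<and> u = a \<and> q = rk B a"
        then show ?thesis
          using trial_complete[OF B(1) a order_refl refl, of z] a by (auto simp: le_max_iff_disj)
      qed
    qed
  qed
  let ?t = "trials s"
  have t: "found ?t = 1" "\<And>w. w < n \<Longrightarrow> best ?t w = rk T w" "\<And>w. w < n \<Longrightarrow> worst ?t w = rk B w"
  proof -
    have P: "?P ?t" and f: "found ?t = 1" and b: "\<forall>w<n. best ?t w \<le> rk T w"
      using 1 P0 w0n rk_bound[OF T(1) w0n] by (auto simp: attains_def)
    show "found ?t = 1" by (rule f)
    show "best ?t w = rk T w" if "w < n" for w using P b that by (simp add: antisym)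
    show "worst ?t w = rk B w" if "w < n" for w
      using 2[OF that] P0 P w0n rk_bound[OF B(1)] that by (force simp: attains_def intro: antisym)
  qed
  let ?E = "fold (\<lambda>w. fold (\<lambda>f. emit w f) [0..<n]) [0..<n]"
  let ?P' = "\<lambda>z :: search_state. best z = best ?t \<and> worst z = worst ?t"
  \<comment> \<open>The recorded rank of \<open>a\<close> occurs at exactly one firm, so the entry
    is written once and not overwritten later.\<close>
  have emit: "attains ?P' (\<lambda>z. wopt z a = T a) ?E (\<exists>w<n. \<exists>f<n. w = a \<and> f = T a)"
    "attains ?P' (\<lambda>z. fopt z a = B a) ?E (\<exists>w<n. \<exists>f<n. w = a \<and> f = B a)" if a: "a < n" for a
  proof -
    have iff: "best ?t a = wrk 0 a f \<longleftrightarrow> f = T a" "worst ?t a = wrk 0 a f \<longleftrightarrow> f = B a" if "f < n" for f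
      using t(2,3)[OF a] wrk_inj[OF k0 a L_less[OF T(1) a] that] wrk_inj[OF k0 a L_less[OF B(1) a] that]
      by (auto simp: rk_def)
    show "attains ?P' (\<lambda>z. wopt z a = T a) ?E (\<exists>w<n. \<exists>f<n. w = a \<and> f = T a)"
      "attains ?P' (\<lambda>z. fopt z a = B a) ?E (\<exists>w<n. \<exists>f<n. w = a \<and> f = B a)"
      using iff by (intro attains_fold; auto simp: attains_def emit_def)+
  qed
  have y: "y = ?E ?t" by (simp add: y run_search_def fold_init s_def)
  have "wopt y w = T w \<and> fopt y w = B w" if "w < n" for w
    using emit[OF that] L_less[OF T(1) that] L_less[OF B(1) that] that unfolding y attains_def by blast
  then show ?thesis using t(1) by (simp add: y found_emit)
qed

lemma search_finds:
  "\<exists>t s. exec search_prog (input n k A) t s \<and> t \<le> 2000 * (n + k) ^ 11 \<and>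
    (if L = {} then s ''found'' [] = 0
     else s ''found'' [] = 1 \<and>
       (\<forall>i<k. worker_optimal {..<n} (A i) L (output_matching n s ''wopt'') \<and>
          firm_optimal {..<n} {..<n} (A i) L (output_matching n s ''fopt'')))"
proof -
  have "agrees Map.empty (input n k A)" by (simp add: agrees_def)
  from computesD[OF computes_search this] obtain t s where
    s: "exec search_prog (input n k A) t s" "t \<le> 2000 * (n + k) ^ 11"
      "search_abs s = run_search (search_abs (input n k A))" .
  have f: "s ''found'' [] = found (search_abs s)" by (simp add: search_abs_def)
  have o: "output_matching n s ''wopt'' = (\<lambda>w\<in>{..<n}. wopt (search_abs s) w)"
    "output_matching n s ''fopt'' = (\<lambda>w\<in>{..<n}. fopt (search_abs s) w)"
    by (simp_all add: output_matching_def search_abs_def)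
  show ?thesis
  proof (cases "L = {}")
    case True
    have "s ''found'' [] = 0"
      using run_search_empty[OF True, of "search_abs (input n k A)"] unfolding f s(3)
      by (simp add: search_abs_def input_def)
    with s(1,2) show ?thesis unfolding if_P[OF True] by blast
  next
    case False
    obtain T where T: "T \<in> L" "\<forall>N\<in>L. match_meet {..<n} (A 0) T N = T"
      using ex_extremal(1)[OF False] by blast
    obtain B where B: "B \<in> L" "\<forall>N\<in>L. match_join {..<n} (A 0) B N = B"
      using ex_extremal(2)[OF False] by blast
    have rT: "rk T w \<le> rk N w" if N: "N \<in> L" and w: "w < n" for N w
    proof -
      have "T w = N w \<or> wpref (A 0) w (T w) (N w)"
        using worker_best[OF T k0] N w by (simp add: worker_optimal_def)
      then show ?thesis
        using wrk_less[OF k0 w L_less[OF T(1) w] L_less[OF N w]] by (auto simp: rk_def)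
    qed
    have rB: "rk N w \<le> rk B w" if N: "N \<in> L" and w: "w < n" for N w
      using worker_worst[OF B k0 N w] wrk_less[OF k0 w L_less[OF N w] L_less[OF B(1) w]]
      by (auto simp: rk_def)
    \<comment> \<open>Cells outside the input are initially 0.\<close>
    have "\<forall>w<n. worst (search_abs (input n k A)) w = 0" by (simp add: search_abs_def input_def)
    from run_search_nonempty[OF T(1) rT B(1) rB this s(3)]
    have r: "found (search_abs s) = 1" "\<And>w. w < n \<Longrightarrow> wopt (search_abs s) w = T w"
      "\<And>w. w < n \<Longrightarrow> fopt (search_abs s) w = B w" by auto
    have ext: "T \<in> extensional {..<n}" "B \<in> extensional {..<n}"
      using stable_matchings_perfect[OF common_stableD[OF T(1) k0]]
        stable_matchings_perfect[OF common_stableD[OF B(1) k0]] by (auto simp: perfect_matching_def)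
    have "output_matching n s ''wopt'' = T" "output_matching n s ''fopt'' = B"
      unfolding o by (rule extensionalityI[of _ "{..<n}"]; use ext r in auto)+
    then have "\<forall>i<k. worker_optimal {..<n} (A i) L (output_matching n s ''wopt'') \<and>
        firm_optimal {..<n} {..<n} (A i) L (output_matching n s ''fopt'')"
      using worker_best[OF T] firm_best[OF B] by simp
    moreover have "s ''found'' [] = 1" using f r(1) by simp
    ultimately show ?thesis using s(1,2) unfolding if_not_P[OF False] by blast
  qed
qed

end

lemma search_prog_correct: "finds_optimal_matchings search_prog (\<lambda>n k. 2000 * (n + k) ^ 11)"
  unfolding finds_optimal_matchings_def
proof (intro allI impI)
  fix n k :: nat and A :: "nat \<Rightarrow> (nat, nat) sm_instance"
  assume "one_worker_family {..<n} {..<n} k A"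
  then obtain w0 where "one_worker {..<n} {..<n} k A w0" by (rule one_worker_familyE)
  then interpret one_worker_search n k A w0 by (simp add: one_worker_search_def)
  show "\<exists>t s. exec search_prog (input n k A) t s \<and> t \<le> 2000 * (n + k) ^ 11 \<and>
      (let L = common_stable {..<n} {..<n} k A in
        if L = {} then s ''found'' [] = 0
        else s ''found'' [] = 1 \<and>
          (\<forall>i<k. worker_optimal {..<n} (A i) L (output_matching n s ''wopt'') \<and>
             firm_optimal {..<n} {..<n} (A i) L (output_matching n s ''fopt'')))"
    using search_finds by (simp only: Let_def)
qed

theorem theorem14:
  "(\<forall>(W :: 'w set) (F :: 'f set) k A. one_worker_family W F k A \<longrightarrow>
      (\<forall>i<k. sublattice W F (A i) (common_stable W F k A)) \<and>
      (\<forall>x \<theta>. feasible W F k A x \<and> \<theta> \<in> {0..1} \<and> (\<forall>i<k. \<theta> \<notin> endpoints W F (A i) x) \<longrightarrow>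
         (\<forall>i<k. \<forall>j<k. rounding W F (A i) x \<theta> = rounding W F (A j) x \<theta>) \<and>
         (\<forall>i<k. rounding W F (A i) x \<theta> \<in> common_stable W F k A))) \<and>
   (\<exists>p c d. finds_optimal_matchings p (\<lambda>n k. c * (n + k) ^ d))"
proof (intro conjI allI impI)
  fix W :: "'w set" and F :: "'f set" and k A
  assume fam: "one_worker_family W F k A"
  then obtain w0 where ow: "one_worker W F k A w0" by (rule one_worker_familyE)
  show "sublattice W F (A i) (common_stable W F k A)" if "i < k" for i
    by (rule one_worker.sublattice_common[OF ow that])
  fix x \<theta>
  assume a: "feasible W F k A x \<and> \<theta> \<in> {0..1} \<and> (\<forall>i<k. \<theta> \<notin> endpoints W F (A i) x)"
  show "rounding W F (A i) x \<theta> = rounding W F (A j) x \<theta>" if "i < k" "j < k" for i j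
    using one_worker.rounding_coincides[OF ow _ _ _ that] a by blast
  show "rounding W F (A i) x \<theta> \<in> common_stable W F k A" if "i < k" for i
    using one_worker.rounding_common_stable[OF ow _ _ _ that] a by blast
next
  show "\<exists>p c d. finds_optimal_matchings p (\<lambda>n k. c * (n + k) ^ d)"
    using search_prog_correct by blast
qed

end
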